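(* Suppose $\phi:T^{(1)}\dashrightarrow T^{(2)}$ is a positively birational map between two tori over $\mathbf K$. Let $W:T^{(2)}\to\mathbf K$ be a positive Laurent polynomial such that $\phi^*(W)$ is a positive Laurent polynomial on $T^{(1)}$. Assume furthermore that $W$ is complete. Then: (1) $\phi^*(W)$ is complete. (2) If $p_{\mathrm{crit}}'$ is the unique positive critical point of $\phi^*(W)$, then $\phi(p_{\mathrm{crit}}')\in T^{(2)}(\mathbf K_{>0})$ is the unique positive critical point $p_{\mathrm{crit}}$ of $W$. (3) The tropical critical points $d_{\mathrm{crit}}=[p_{\mathrm{crit}}]$ of $W$ and $d_{\mathrm{crit}}'=[p_{\mathrm{crit}}']$ of $\phi^*(W)$ are related by $\operatorname{Trop}(\phi)(d_{\mathrm{crit}}')=d_{\mathrm{crit}}$.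
   Context: $\mathbf K$ is the field of generalised Puiseux series $c(t)=\sum_kc_{\mu_k}t^{\mu_k}$, $c_{\mu_k}\in\mathbb C$, with real exponents forming a strictly increasing sequence that is finite or tends to $+\infty$; $\operatorname{Val}_{\mathbf K}$ is the lowest exponent with nonzero coefficient; $\mathbf K_{>0}$ is the set of nonzero series with leading coefficient in $\mathbb R_{>0}$. For a split torus $T$ over $\mathbf K$ with character lattice $M$ and cocharacter lattice $N$: $T(\mathbf K_{>0})=\operatorname{Hom}(M,\mathbf K_{>0})$, and $p^v$ is the value of $p$ on $v\in M$. A positive Laurent polynomial on $T$ is $W=\sum_i\gamma_ix^{v_i}$ with $\gamma_i\in\mathbf K_{>0}$ and distinct $v_i\in M$; it is complete if $\operatorname{ConvexHull}(\{v_i\})\subset M\otimes\mathbb R$ is full-dimensional with $0$ in its interior. A positive critical point of $W$ is a $p\in T(\mathbf K_{>0})$ with $\sum_i\gamma_i\langle v_i,u\rangle p^{v_i}=0$ for all $u\in N$; every complete, positive Laurent polynomial has exactly one. A positive rational map $\phi:T^{(1)}\dashrightarrow T^{(2)}$ is a rational map such that for every character $\chi$ of $T^{(2)}$ the composition $\chi\circ\phi$ is a quotient of positive Laurent polynomials on $T^{(1)}$. Such a map induces a map $T^{(1)}(\mathbf K_{>0})\to T^{(2)}(\mathbf K_{>0})$, everywhere defined. It is positively birational if it has an inverse $\phi^{-1}:T^{(2)}\dashrightarrow T^{(1)}$ that is also a positive rational map. $\operatorname{Trop}(T)=T(\mathbf K_{>0})/\!\sim$, where $x\sim x'$ iff $\operatorname{Val}_{\mathbf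 K}(\chi(x))=\operatorname{Val}_{\mathbf K}(\chi(x'))$ for all characters $\chi$ of $T$; $[x]$ denotes the class of $x$. For a positive rational map $\phi$, $\operatorname{Trop}(\phi):\operatorname{Trop}(T^{(1)})\to\operatorname{Trop}(T^{(2)})$ is the (well-defined) induced map $[x]\mapsto[\phi(x)]$. The tropical critical point of a complete, positive Laurent polynomial is the class of its positive critical point. *)

theory Defs
  imports "HOL-Analysis.Analysis" "HOL-Analysis.Finite_Function_Topology" "HOL-Computational_Algebra.Fraction_Field"
begin

section \<open>Generalised Puiseux series\<close>

text \<open>A series is its coefficient function. The support condition says that the exponents form a
  strictly increasing sequence that is finite or tends to infinity, see \<open>loc_finite_iff_sequence\<close>.\<close>

definition loc_finite :: "(real \<Rightarrow> complex) \<Rightarrow> bool" where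
  "loc_finite c \<longleftrightarrow> (\<forall>b. finite {\<mu>. c \<mu> \<noteq> 0 \<and> \<mu> \<le> b})"

lemma loc_finite_least:
  assumes c: "loc_finite c" and T: "T \<subseteq> {\<mu>. c \<mu> \<noteq> 0}" "T \<noteq> {}"
  shows "\<exists>z\<in>T. \<forall>y\<in>T. z \<le> y"
proof -
  obtain w where w: "w \<in> T" using T by blast
  define z where "z = Min {y\<in>T. y \<le> w}"
  have "finite {\<mu>. c \<mu> \<noteq> 0 \<and> \<mu> \<le> w}" using c by (simp add: loc_finite_def)
  then have f: "finite {y\<in>T. y \<le> w}" by (rule rev_finite_subset) (use T in auto)
  have "z \<in> {y\<in>T. y \<le> w}" unfolding z_def using f w by (intro Min_in) auto
  then have z: "z \<in> T" "z \<le> w" by auto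
  have "z \<le> y" if "y \<in> T" for y
  proof (cases "y \<le> w")
    case True
    then show ?thesis unfolding z_def using f that by (intro Min_le) auto
  qed (use z in simp)
  then show ?thesis using z by blast
qed

lemma loc_finite_iff_sequence:
  "loc_finite c \<longleftrightarrow> finite {\<mu>. c \<mu> \<noteq> 0} \<or>
     (\<exists>\<mu> :: nat \<Rightarrow> real. strict_mono \<mu> \<and> filterlim \<mu> at_top sequentially \<and> {x. c x \<noteq> 0} = range \<mu>)"
proof
  assume c: "loc_finite c"
  define S where "S = {x. c x \<noteq> 0}"
  have fin: "finite {x\<in>S. x \<le> b}" for b
    using c by (auto simp: loc_finite_def S_def)
  show "finite {\<mu>. c \<mu> \<noteq> 0} \<or>
     (\<exists>\<mu> :: nat \<Rightarrow> real. strict_mono \<mu> \<and> filterlim \<mu> at_top sequentially \<and> {x. c x \<noteq> 0} = range \<mu>)"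
  proof (cases "finite S")
    case True
    then show ?thesis by (simp add: S_def)
  next
    case False
    define N where "N x = card {y\<in>S. y < x}" for x
    have finl: "finite {y\<in>S. y < x}" for x
      by (rule finite_subset[OF _ fin[of x]]) auto
    have N_less: "N x < N y" if "x \<in> S" "x < y" for x y
      unfolding N_def using that by (intro psubset_card_mono finl) force
    have ex: "\<exists>x\<in>S. N x = k" for k
    proof -
      have least: "\<exists>z\<in>T. \<forall>y\<in>T. z \<le> y" if "T \<subseteq> S" "T \<noteq> {}" for T
        using loc_finite_least[OF c] that by (simp add: S_def)
      show ?thesis
      proof (induction k)
        case 0
        have "S \<noteq> {}" using False by auto
        then obtain z where "z \<in> S" "\<forall>y\<in>S. z \<le> y" using least[of S] by blast
        then have "{y\<in>S. y < z} = {}" by force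
        then have "N z = 0" unfolding N_def by (metis card.empty)
        then show ?case using \<open>z \<in> S\<close> by blast
      next
        case (Suc k)
        then obtain x where x: "x \<in> S" "N x = k" by blast
        have "{y\<in>S. x < y} \<noteq> {}"
        proof
          assume "{y\<in>S. x < y} = {}"
          then have "S \<subseteq> {y\<in>S. y \<le> x}" by force
          then show False using False fin[of x] finite_subset by blast
        qed
        then obtain z where z: "z \<in> S" "x < z" "\<forall>y\<in>{y\<in>S. x < y}. z \<le> y"
          using least[of "{y\<in>S. x < y}"] by auto
        have "{y\<in>S. y < z} = insert x {y\<in>S. y < x}"
          using z x by force
        then have "N z = Suc (N x)" unfolding N_def using finl[of x] by simp
        then show ?case using x z by auto
      qed
    qed
    define \<mu> where "\<mu> k = (SOME x. x \<in> S \<and> N x = k)" for k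
    have \<mu>: "\<mu> k \<in> S \<and> N (\<mu> k) = k" for k
      unfolding \<mu>_def by (rule someI_ex) (use ex[of k] in blast)
    have mono: "strict_mono \<mu>"
    proof (rule strict_monoI)
      fix i j :: nat assume "i < j"
      then show "\<mu> i < \<mu> j"
        using N_less[of "\<mu> j" "\<mu> i"] \<mu>[of i] \<mu>[of j]
        by (metis less_asym linorder_less_linear less_irrefl)
    qed
    have "S = range \<mu>"
    proof
      show "S \<subseteq> range \<mu>"
      proof
        fix x assume x: "x \<in> S"
        have "\<mu> (N x) = x"
          using N_less[of x "\<mu> (N x)"] N_less[of "\<mu> (N x)" x] \<mu>[of "N x"] x
          by (metis less_irrefl linorder_less_linear)
        then show "x \<in> range \<mu>" by (metis rangeI)
      qed
    qed (use \<mu> in auto)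
    moreover have "filterlim \<mu> at_top sequentially"
      unfolding filterlim_at_top eventually_sequentially
    proof (intro allI)
      fix Z :: real
      have "finite {k. \<mu> k \<le> Z}"
        by (rule finite_imageD[of \<mu>], rule finite_subset[OF _ fin[of Z]])
           (use \<mu> strict_mono_imp_inj_on[OF mono] in \<open>auto intro: inj_on_subset\<close>)
      then obtain K where K: "\<forall>k\<in>{k. \<mu> k \<le> Z}. k < K"
        using finite_nat_set_iff_bounded by blast
      have "Z \<le> \<mu> n" if "n \<ge> K" for n using K that by (meson leD le_cases mem_Collect_eq)
      then show "\<exists>K. \<forall>n\<ge>K. Z \<le> \<mu> n" by blast
    qed
    ultimately show ?thesis using mono unfolding S_def by blast
  qed
next
  assume "finite {\<mu>. c \<mu> \<noteq> 0} \<or>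
     (\<exists>\<mu> :: nat \<Rightarrow> real. strict_mono \<mu> \<and> filterlim \<mu> at_top sequentially \<and> {x. c x \<noteq> 0} = range \<mu>)"
  then show "loc_finite c"
  proof
    assume f: "finite {\<mu>. c \<mu> \<noteq> 0}"
    show "loc_finite c" unfolding loc_finite_def
      by (intro allI finite_subset[OF _ f]) auto
  next
    assume "\<exists>\<mu> :: nat \<Rightarrow> real. strict_mono \<mu> \<and> filterlim \<mu> at_top sequentially \<and> {x. c x \<noteq> 0} = range \<mu>"
    then obtain \<mu> :: "nat \<Rightarrow> real" where \<mu>: "filterlim \<mu> at_top sequentially" "{x. c x \<noteq> 0} = range \<mu>"
      by blast
    show "loc_finite c" unfolding loc_finite_def
    proof
      fix b
      obtain K where K: "\<And>n. n \<ge> K \<Longrightarrow> b + 1 \<le> \<mu> n"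
        using \<mu>(1) unfolding filterlim_at_top eventually_sequentially by blast
      have "{x. c x \<noteq> 0 \<and> x \<le> b} \<subseteq> \<mu> ` {..<K}"
      proof
        fix x assume x: "x \<in> {x. c x \<noteq> 0 \<and> x \<le> b}"
        then obtain k where "x = \<mu> k" using \<mu>(2) by blast
        then show "x \<in> \<mu> ` {..<K}" using K[of k] x by (cases "k < K") auto
      qed
      then show "finite {x. c x \<noteq> 0 \<and> x \<le> b}" using finite_subset by blast
    qed
  qed
qed

lemma loc_finite_lower_bound:
  assumes "loc_finite c" shows "\<exists>m. \<forall>x<m. c x = 0"
proof -
  define T where "T = insert 0 {x. c x \<noteq> 0 \<and> x \<le> 0}"
  have f: "finite T" using assms by (simp add: T_def loc_finite_def)
  have "c x = 0" if "x < Min T" for x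
  proof (rule ccontr)
    assume "c x \<noteq> 0"
    moreover have "Min T \<le> 0" using f by (intro Min_le) (auto simp: T_def)
    ultimately have "x \<in> T" using that by (simp add: T_def)
    then have "Min T \<le> x" using f by (intro Min_le)
    then show False using that by simp
  qed
  then show ?thesis by blast
qed

definition conv :: "(real \<Rightarrow> complex) \<Rightarrow> (real \<Rightarrow> complex) \<Rightarrow> real \<Rightarrow> complex" where
  "conv f g x = (\<Sum>a | f a \<noteq> 0 \<and> g (x - a) \<noteq> 0. f a * g (x - a))"

lemma conv_eq:
  assumes "finite A" "\<And>a. f a \<noteq> 0 \<Longrightarrow> a \<le> x - m \<Longrightarrow> a \<in> A" "\<And>y. y < m \<Longrightarrow> g y = 0"
  shows "conv f g x = (\<Sum>a\<in>A. f a * g (x - a))"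
  unfolding conv_def
proof (rule sum.mono_neutral_left)
  show "{a. f a \<noteq> 0 \<and> g (x - a) \<noteq> 0} \<subseteq> A"
  proof
    fix a assume a: "a \<in> {a. f a \<noteq> 0 \<and> g (x - a) \<noteq> 0}"
    then have "\<not> x - a < m" using assms(3) by blast
    then show "a \<in> A" using a by (intro assms(2)) auto
  qed
qed (use assms(1) in auto)

lemma conv_commute: "conv f g x = conv g f x"
  unfolding conv_def
  by (rule sum.reindex_bij_witness[where i = "\<lambda>a. x - a" and j = "\<lambda>a. x - a"]) auto

lemma conv_eq':
  assumes "finite A" "\<And>a. g a \<noteq> 0 \<Longrightarrow> a \<le> x - m \<Longrightarrow> a \<in> A" "\<And>y. y < m \<Longrightarrow> f y = 0"
  shows "conv f g x = (\<Sum>a\<in>A. f (x - a) * g a)"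
  using conv_eq[of A g x m f] assms by (simp add: conv_commute[of f g] mult.commute)

lemma conv_below:
  assumes "\<And>y. y < m \<Longrightarrow> f y = 0" "\<And>y. y < n \<Longrightarrow> g y = 0" "x < m + n"
  shows "conv f g x = 0"
proof -
  have "conv f g x = (\<Sum>a\<in>{}. f a * g (x - a))"
    by (rule conv_eq[where m = n]) (use assms in force)+
  then show ?thesis by simp
qed

lemma loc_finite_conv:
  assumes "loc_finite f" "loc_finite g" shows "loc_finite (conv f g)"
  unfolding loc_finite_def
proof
  fix b
  obtain m where m: "\<And>x. x < m \<Longrightarrow> f x = 0" using loc_finite_lower_bound[OF assms(1)] by blast
  obtain n where n: "\<And>x. x < n \<Longrightarrow> g x = 0" using loc_finite_lower_bound[OF assms(2)] by blast
  let ?F = "{x. f x \<noteq> 0 \<and> x \<le> b - n}" and ?G = "{x. g x \<noteq> 0 \<and> x \<le> b - m}"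
  have "{x. conv f g x \<noteq> 0 \<and> x \<le> b} \<subseteq> (\<lambda>(u, v). u + v) ` (?F \<times> ?G)"
  proof
    fix x assume x: "x \<in> {x. conv f g x \<noteq> 0 \<and> x \<le> b}"
    then have "{a. f a \<noteq> 0 \<and> g (x - a) \<noteq> 0} \<noteq> {}"
      unfolding conv_def by (intro notI) simp
    then obtain a where a: "f a \<noteq> 0" "g (x - a) \<noteq> 0" by auto
    then have "\<not> a < m" "\<not> x - a < n" using m n by blast+
    then have "(a, x - a) \<in> ?F \<times> ?G" using a x by auto
    then show "x \<in> (\<lambda>(u, v). u + v) ` (?F \<times> ?G)" by force
  qed
  moreover have "finite (?F \<times> ?G)" using assms by (simp add: loc_finite_def)
  ultimately show "finite {x. conv f g x \<noteq> 0 \<and> x \<le> b}" using finite_surj by blast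
qed

lemma conv_assoc:
  assumes "loc_finite f" "loc_finite g" "loc_finite h"
  shows "conv (conv f g) h x = conv f (conv g h) x"
proof -
  obtain m where m: "\<And>x. x < m \<Longrightarrow> f x = 0" using loc_finite_lower_bound[OF assms(1)] by blast
  obtain n where n: "\<And>x. x < n \<Longrightarrow> g x = 0" using loc_finite_lower_bound[OF assms(2)] by blast
  obtain l where l: "\<And>x. x < l \<Longrightarrow> h x = 0" using loc_finite_lower_bound[OF assms(3)] by blast
  define A where "A = {a. f a \<noteq> 0 \<and> a \<le> x - (n + l)}"
  define C where "C = {a. h a \<noteq> 0 \<and> a \<le> x - (m + n)}"
  have fin: "finite A" "finite C" using assms by (simp_all add: A_def C_def loc_finite_def)
  have "conv (conv f g) h x = (\<Sum>c\<in>C. conv f g (x - c) * h c)"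
    by (rule conv_eq'[where m = "m + n"]) (use fin m n in \<open>auto simp: C_def intro!: conv_below[where m = m and n = n]\<close>)
  also have "\<dots> = (\<Sum>c\<in>C. (\<Sum>a\<in>A. f a * g (x - c - a)) * h c)"
  proof (rule sum.cong[OF refl])
    fix c assume "c \<in> C"
    then have "\<not> c < l" using l by (auto simp: C_def)
    have "conv f g (x - c) = (\<Sum>a\<in>A. f a * g (x - c - a))"
      by (rule conv_eq[where m = n]) (use fin n \<open>\<not> c < l\<close> in \<open>auto simp: A_def\<close>)
    then show "conv f g (x - c) * h c = (\<Sum>a\<in>A. f a * g (x - c - a)) * h c" by simp
  qed
  also have "\<dots> = (\<Sum>a\<in>A. f a * (\<Sum>c\<in>C. g (x - a - c) * h c))"
    by (simp add: sum_distrib_left sum_distrib_right sum.swap[of _ C A] algebra_simps)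
  also have "\<dots> = (\<Sum>a\<in>A. f a * conv g h (x - a))"
  proof (rule sum.cong[OF refl])
    fix a assume "a \<in> A"
    then have "\<not> a < m" using m by (auto simp: A_def)
    have "conv g h (x - a) = (\<Sum>c\<in>C. g (x - a - c) * h c)"
      by (rule conv_eq'[where m = n]) (use fin n \<open>\<not> a < m\<close> in \<open>auto simp: C_def\<close>)
    then show "f a * (\<Sum>c\<in>C. g (x - a - c) * h c) = f a * conv g h (x - a)" by simp
  qed
  also have "\<dots> = conv f (conv g h) x"
    by (rule conv_eq[where m = "n + l", symmetric])
       (use fin l n in \<open>auto simp: A_def intro!: conv_below[where m = n and n = l]\<close>)
  finally show ?thesis .
qed

lemma conv_add:
  assumes "loc_finite f" "loc_finite g" "loc_finite h"
  shows "conv (\<lambda>x. f x + g x) h x = conv f h x + conv g h x"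
proof -
  obtain m where m: "\<And>x. x < m \<Longrightarrow> f x = 0" using loc_finite_lower_bound[OF assms(1)] by blast
  obtain n where n: "\<And>x. x < n \<Longrightarrow> g x = 0" using loc_finite_lower_bound[OF assms(2)] by blast
  define C where "C = {a. h a \<noteq> 0 \<and> a \<le> x - min m n}"
  have fin: "finite C" using assms by (simp add: C_def loc_finite_def)
  have "conv k h x = (\<Sum>a\<in>C. k (x - a) * h a)" if "\<And>y. y < min m n \<Longrightarrow> k y = 0" for k
    by (rule conv_eq'[where m = "min m n"]) (use fin that in \<open>auto simp: C_def\<close>)
  from this[of f] this[of g] this[of "\<lambda>x. f x + g x"] show ?thesis
    using m n by (simp add: sum.distrib distrib_right)
qed

lemma conv_one: "conv (\<lambda>x. if x = 0 then 1 else 0) g x = g x"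
proof -
  have "{a. (if a = 0 then 1 else 0 :: complex) \<noteq> 0 \<and> g (x - a) \<noteq> 0} = (if g x \<noteq> 0 then {0} else {})"
    by (auto split: if_splits)
  then show ?thesis by (simp add: conv_def)
qed

typedef puiseux = "{c. loc_finite c}"
  morphisms pcoeff Abs_puiseux
  by (rule exI[of _ "\<lambda>_. 0"]) (simp add: loc_finite_def)

setup_lifting type_definition_puiseux

instantiation puiseux :: comm_ring_1
begin

lift_definition zero_puiseux :: puiseux is "\<lambda>_. 0"
  by (simp add: loc_finite_def)

lift_definition one_puiseux :: puiseux is "\<lambda>x. if x = 0 then 1 else 0"
  by (simp add: loc_finite_def conj_commute)

lift_definition plus_puiseux :: "puiseux \<Rightarrow> puiseux \<Rightarrow> puiseux" is "\<lambda>f g x. f x + g x"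
proof -
  fix f g assume "loc_finite f" "loc_finite g"
  then have "finite ({x. f x \<noteq> 0 \<and> x \<le> b} \<union> {x. g x \<noteq> 0 \<and> x \<le> b})" for b
    by (simp add: loc_finite_def)
  moreover have "{x. f x + g x \<noteq> 0 \<and> x \<le> b} \<subseteq> {x. f x \<noteq> 0 \<and> x \<le> b} \<union> {x. g x \<noteq> 0 \<and> x \<le> b}" for b
    by auto
  ultimately have "finite {x. f x + g x \<noteq> 0 \<and> x \<le> b}" for b
    by (meson finite_subset)
  then show "loc_finite (\<lambda>x. f x + g x)" by (simp add: loc_finite_def)
qed

lift_definition uminus_puiseux :: "puiseux \<Rightarrow> puiseux" is "\<lambda>f x. - f x"
  by (simp add: loc_finite_def)

definition minus_puiseux :: "puiseux \<Rightarrow> puiseux \<Rightarrow> puiseux" where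
  "minus_puiseux f g = f + - g"

lift_definition times_puiseux :: "puiseux \<Rightarrow> puiseux \<Rightarrow> puiseux" is conv
  by (rule loc_finite_conv)

instance
proof
  fix a b c :: puiseux
  show "a + b + c = a + (b + c)" by transfer (simp add: add.assoc)
  show "a + b = b + a" by transfer (simp add: add.commute)
  show "0 + a = a" by transfer simp
  show "- a + a = 0" by transfer simp
  show "a - b = a + - b" by (rule minus_puiseux_def)
  show "a * b * c = a * (b * c)" by transfer (intro ext conv_assoc)
  show "a * b = b * a" by transfer (intro ext conv_commute)
  show "1 * a = a" by transfer (intro ext conv_one)
  show "(a + b) * c = a * c + b * c" by transfer (intro ext conv_add)
  have "pcoeff 0 0 \<noteq> pcoeff 1 0" by (simp add: zero_puiseux.rep_eq one_puiseux.rep_eq)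
  then show "(0::puiseux) \<noteq> 1" by metis
qed

end

lemma pcoeff_times_below:
  assumes "\<And>x. x < m \<Longrightarrow> pcoeff f x = 0" "\<And>x. x < n \<Longrightarrow> pcoeff g x = 0" "x < m + n"
  shows "pcoeff (f * g) x = 0"
  using conv_below[of m "pcoeff f" n "pcoeff g" x] assms by (simp add: times_puiseux.rep_eq)

lemma pcoeff_minus: "pcoeff (f - g) x = pcoeff f x - pcoeff g x"
  unfolding minus_puiseux_def plus_puiseux.rep_eq uminus_puiseux.rep_eq by simp

lemma pcoeff_sum: "pcoeff (sum f A) x = (\<Sum>a\<in>A. pcoeff (f a) x)"
  by (induction A rule: infinite_finite_induct) (simp_all add: zero_puiseux.rep_eq plus_puiseux.rep_eq)

lemma puiseux_geometric_inverse:
  assumes e: "e > 0" and y: "\<And>x. x < e \<Longrightarrow> pcoeff y x = 0"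
  shows "\<exists>g. (1 - y) * g = 1"
proof -
  have pow: "pcoeff (y ^ n) x = 0" if "x < of_nat n * e" for n x
    using that
  proof (induction n arbitrary: x)
    case (Suc n)
    have "pcoeff (y * y ^ n) x = 0"
      by (rule pcoeff_times_below[where m = e and n = "of_nat n * e"])
         (use y Suc in \<open>auto simp: algebra_simps\<close>)
    then show ?case by simp
  qed (simp add: one_puiseux.rep_eq)
  define N where "N x = nat \<lceil>x / e\<rceil> + 1" for x
  have N: "x < of_nat (N x) * e" for x
  proof -
    have "x / e < of_nat (N x)" unfolding N_def by linarith
    then show ?thesis using e by (simp add: field_simps)
  qed
  define G where "G x = (\<Sum>n<N x. pcoeff (y ^ n) x)" for x
  have G: "G x = (\<Sum>n<M. pcoeff (y ^ n) x)" if M: "x < of_nat M * e" for x M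
  proof -
    have z: "pcoeff (y ^ n) x = 0" if "n \<ge> min (N x) M" for n
    proof (rule pow)
      have "x < of_nat (min (N x) M) * e" using N[of x] M by (simp add: min_def)
      also have "\<dots> \<le> of_nat n * e" using that e by (intro mult_right_mono) auto
      finally show "x < of_nat n * e" .
    qed
    have "sum (\<lambda>n. pcoeff (y ^ n) x) {..<L} = sum (\<lambda>n. pcoeff (y ^ n) x) {..<min (N x) M}"
      if "L \<ge> min (N x) M" for L
      by (rule sum.mono_neutral_right) (use that z in auto)
    from this[of "N x"] this[of M] show ?thesis by (simp add: G_def)
  qed
  have "loc_finite G"
    unfolding loc_finite_def
  proof
    fix b
    have "{x. G x \<noteq> 0 \<and> x \<le> b} \<subseteq> (\<Union>n<N b. {x. pcoeff (y ^ n) x \<noteq> 0 \<and> x \<le> b})"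
    proof
      fix x assume x: "x \<in> {x. G x \<noteq> 0 \<and> x \<le> b}"
      then have "G x = (\<Sum>n<N b. pcoeff (y ^ n) x)" using N[of b] by (intro G) auto
      then show "x \<in> (\<Union>n<N b. {x. pcoeff (y ^ n) x \<noteq> 0 \<and> x \<le> b})"
        using x by (auto elim: sum.not_neutral_contains_not_neutral)
    qed
    moreover have "finite (\<Union>n<N b. {x. pcoeff (y ^ n) x \<noteq> 0 \<and> x \<le> b})"
      using pcoeff by (auto simp: loc_finite_def)
    ultimately show "finite {x. G x \<noteq> 0 \<and> x \<le> b}" by (rule finite_subset)
  qed
  then have pG: "pcoeff (Abs_puiseux G) = G" by (simp add: Abs_puiseux_inverse)
  have "pcoeff ((1 - y) * Abs_puiseux G) x = pcoeff 1 x" for x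
  proof -
    define S where "S = (\<Sum>n<N x. y ^ n)"
    have "pcoeff ((1 - y) * (Abs_puiseux G - S)) x = 0"
    proof (rule pcoeff_times_below[where m = 0 and n = "of_nat (N x) * e"])
      show "pcoeff (1 - y) z = 0" if "z < 0" for z
        using that e y[of z] by (simp add: pcoeff_minus one_puiseux.rep_eq)
      show "pcoeff (Abs_puiseux G - S) z = 0" if "z < of_nat (N x) * e" for z
        using G[OF that] by (simp add: pcoeff_minus pG S_def pcoeff_sum)
    qed (use N[of x] in simp)
    moreover have "(1 - y) * S = 1 - y ^ N x"
      unfolding S_def by (rule one_diff_power_eq[symmetric])
    moreover have "pcoeff (y ^ N x) x = 0" by (rule pow[OF N])
    ultimately show ?thesis by (simp add: right_diff_distrib pcoeff_minus)
  qed
  then have "(1 - y) * Abs_puiseux G = 1" by (simp add: pcoeff_inject[symmetric] fun_eq_iff)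
  then show ?thesis by blast
qed

lemma puiseux_inverse_exists:
  fixes f :: puiseux
  assumes "f \<noteq> 0" shows "\<exists>g. f * g = 1"
proof -
  have lf: "loc_finite (pcoeff g)" for g using pcoeff[of g] by simp
  have "pcoeff f \<noteq> (\<lambda>_. 0)" using assms by (simp add: pcoeff_inject[symmetric] zero_puiseux.rep_eq)
  then have "{x. pcoeff f x \<noteq> 0} \<noteq> {}" by auto
  then obtain m where m: "pcoeff f m \<noteq> 0" "\<forall>y\<in>{x. pcoeff f x \<noteq> 0}. m \<le> y"
    using loc_finite_least[OF lf subset_refl] by blast
  define u where "u = Abs_puiseux (\<lambda>x. if x = - m then inverse (pcoeff f m) else 0)"
  have "loc_finite (\<lambda>x. if x = - m then inverse (pcoeff f m) else 0)"
    unfolding loc_finite_def by (rule allI, rule finite_subset[of _ "{- m}"]) (auto split: if_splits)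
  then have u: "pcoeff u = (\<lambda>x. if x = - m then inverse (pcoeff f m) else 0)"
    by (simp add: u_def Abs_puiseux_inverse)
  have uf: "pcoeff (u * f) x = inverse (pcoeff f m) * pcoeff f (x + m)" for x
  proof -
    have "conv (pcoeff u) (pcoeff f) x = (\<Sum>a\<in>{- m}. pcoeff u a * pcoeff f (x - a))"
      unfolding conv_def by (rule sum.mono_neutral_left) (auto simp: u split: if_splits)
    then show ?thesis by (simp add: times_puiseux.rep_eq u)
  qed
  define y where "y = 1 - u * f"
  have y: "pcoeff y x = 0" if "x \<le> 0" for x
  proof (cases "x = 0")
    case True
    then show ?thesis using m by (simp add: y_def pcoeff_minus one_puiseux.rep_eq uf)
  next
    case False
    then have "\<not> m \<le> x + m" using that by simp
    then have "pcoeff f (x + m) = 0" using m(2) by auto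
    then show ?thesis using False by (simp add: y_def pcoeff_minus one_puiseux.rep_eq uf)
  qed
  have "\<exists>e>0. \<forall>x<e. pcoeff y x = 0"
  proof (cases "{x. pcoeff y x \<noteq> 0} = {}")
    case True
    then show ?thesis by (intro exI[of _ 1]) auto
  next
    case False
    then obtain z where z: "pcoeff y z \<noteq> 0" "\<forall>x\<in>{x. pcoeff y x \<noteq> 0}. z \<le> x"
      using loc_finite_least[OF lf subset_refl] by blast
    have "0 < z" using y[of z] z(1) by (meson not_le)
    moreover have "\<forall>x<z. pcoeff y x = 0" using z(2) by force
    ultimately show ?thesis by blast
  qed
  then obtain g where "(1 - y) * g = 1" using puiseux_geometric_inverse by blast
  then have "f * (u * g) = 1" by (simp add: y_def ac_simps)
  then show ?thesis by blast
qed

instantiation puiseux :: field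
begin

definition inverse_puiseux :: "puiseux \<Rightarrow> puiseux" where
  "inverse_puiseux f = (if f = 0 then 0 else (SOME g. f * g = 1))"

definition divide_puiseux :: "puiseux \<Rightarrow> puiseux \<Rightarrow> puiseux" where
  "divide_puiseux f g = f * inverse g"

instance
proof
  fix a b :: puiseux
  show "inverse a * a = 1" if "a \<noteq> 0"
    using someI_ex[OF puiseux_inverse_exists[OF that]] that
    by (simp add: inverse_puiseux_def mult.commute)
  show "a div b = a * inverse b" by (rule divide_puiseux_def)
  show "inverse (0::puiseux) = 0" by (simp add: inverse_puiseux_def)
qed

end

definition pval :: "puiseux \<Rightarrow> real" where
  "pval f = (LEAST \<mu>. pcoeff f \<mu> \<noteq> 0)" \<comment> \<open>only meaningful for \<open>f \<noteq> 0\<close>\<close>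

definition Kpos :: "puiseux set" where
  "Kpos = {f. f \<noteq> 0 \<and> (\<exists>r>0. pcoeff f (pval f) = complex_of_real r)}"


section \<open>Tori and Laurent polynomials\<close>

text \<open>A split torus of rank \<open>n\<close> is taken in coordinates: its character lattice \<open>M\<close> and its
  cocharacter lattice \<open>N\<close> are both \<open>\<int>\<^sup>n\<close>, realised as the integer vectors supported on \<open>{..<n}\<close>, so
  that \<open>n = 0\<close> is allowed. The group algebra of all finitely supported integer vectors is an
  integral domain in the library; \<open>K[M]\<close> is the subring \<open>laurents n\<close>, and the function field
  \<open>K(T)\<close> is \<open>ratfuns n\<close>.\<close>

type_synonym lattice = "nat \<Rightarrow>\<^sub>0 int"
type_synonym laurent = "lattice \<Rightarrow>\<^sub>0 puiseux"
type_synonym ratfun = "laurent fract"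

definition lat :: "nat \<Rightarrow> lattice set" where
  "lat n = {v. Poly_Mapping.keys v \<subseteq> {..<n}}"

definition pairing :: "lattice \<Rightarrow> lattice \<Rightarrow> int" where
  "pairing v u = (\<Sum>i\<in>Poly_Mapping.keys v. Poly_Mapping.lookup v i * Poly_Mapping.lookup u i)"

definition laurents :: "nat \<Rightarrow> laurent set" where
  "laurents n = {f. Poly_Mapping.keys f \<subseteq> lat n}"

definition ratfuns :: "nat \<Rightarrow> ratfun set" where
  "ratfuns n = {Fract P Q | P Q. P \<in> laurents n \<and> Q \<in> laurents n \<and> Q \<noteq> 0}"

definition positive_laurent :: "nat \<Rightarrow> laurent \<Rightarrow> bool" where
  "positive_laurent n W \<longleftrightarrow> W \<in> laurents n \<and> W \<noteq> 0 \<and>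
     (\<forall>v\<in>Poly_Mapping.keys W. Poly_Mapping.lookup W v \<in> Kpos)"

text \<open>\<open>M \<otimes> \<real>\<close> with its Euclidean topology, as a subspace of the normed space of finitely supported
  real vectors. Interior points are taken relative to all of \<open>M \<otimes> \<real>\<close> (not to the affine hull), which
  forces the convex hull to be full-dimensional.\<close>

definition real_lat :: "nat \<Rightarrow> (nat \<Rightarrow>\<^sub>0 real) set" where
  "real_lat n = {x. Poly_Mapping.keys x \<subseteq> {..<n}}"

definition newton_polytope :: "laurent \<Rightarrow> (nat \<Rightarrow>\<^sub>0 real) set" where
  "newton_polytope W = convex hull (Poly_Mapping.map real_of_int ` Poly_Mapping.keys W)"

definition complete_laurent :: "nat \<Rightarrow> laurent \<Rightarrow> bool" where
  "complete_laurent n W \<longleftrightarrow> 0 \<in> (top_of_set (real_lat n)) interior_of (newton_polytope W)"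


section \<open>Positive points and critical points\<close>

text \<open>\<open>T(K\<^sub>>\<^sub>0) = Hom(M, K\<^sub>>\<^sub>0)\<close>; homomorphisms are extensional functions, so that equality of
  points is equality on \<open>M\<close>.\<close>

definition pos_points :: "nat \<Rightarrow> (lattice \<Rightarrow> puiseux) set" where
  "pos_points n = {p \<in> lat n \<rightarrow>\<^sub>E Kpos. \<forall>v\<in>lat n. \<forall>w\<in>lat n. p (v + w) = p v * p w}"

definition laurent_eval :: "laurent \<Rightarrow> (lattice \<Rightarrow> puiseux) \<Rightarrow> puiseux" where
  "laurent_eval f p = (\<Sum>v\<in>Poly_Mapping.keys f. Poly_Mapping.lookup f v * p v)"

definition positive_critical_point :: "nat \<Rightarrow> laurent \<Rightarrow> (lattice \<Rightarrow> puiseux) \<Rightarrow> bool" where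
  "positive_critical_point n W p \<longleftrightarrow> p \<in> pos_points n \<and>
     (\<forall>u\<in>lat n. (\<Sum>v\<in>Poly_Mapping.keys W.
        Poly_Mapping.lookup W v * of_int (pairing v u) * p v) = 0)"

definition unique_positive_critical_point :: "nat \<Rightarrow> laurent \<Rightarrow> (lattice \<Rightarrow> puiseux) \<Rightarrow> bool" where
  "unique_positive_critical_point n W p \<longleftrightarrow> positive_critical_point n W p \<and>
     (\<forall>q. positive_critical_point n W q \<longrightarrow> q = p)"


section \<open>Positive rational maps\<close>

text \<open>A rational map \<open>\<phi>\<close> from the torus of rank \<open>n1\<close> to the torus of rank \<open>n2\<close> is given by the group
  homomorphism \<open>v \<mapsto> v \<circ> \<phi>\<close> from the characters of the target to the nonzero rational functions on the
  source; only its values on \<open>lat n2\<close> matter.\<close>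

definition rational_map :: "nat \<Rightarrow> nat \<Rightarrow> (lattice \<Rightarrow> ratfun) \<Rightarrow> bool" where
  "rational_map n1 n2 \<phi> \<longleftrightarrow> (\<forall>v\<in>lat n2. \<phi> v \<in> ratfuns n1 \<and> \<phi> v \<noteq> 0) \<and>
     (\<forall>v\<in>lat n2. \<forall>v'\<in>lat n2. \<phi> (v + v') = \<phi> v * \<phi> v')"

definition positive_rational_map :: "nat \<Rightarrow> nat \<Rightarrow> (lattice \<Rightarrow> ratfun) \<Rightarrow> bool" where
  "positive_rational_map n1 n2 \<phi> \<longleftrightarrow> rational_map n1 n2 \<phi> \<and>
     (\<forall>v\<in>lat n2. \<exists>P Q. positive_laurent n1 P \<and> positive_laurent n1 Q \<and> \<phi> v = Fract P Q)"

definition pullback_laurent :: "(lattice \<Rightarrow> ratfun) \<Rightarrow> laurent \<Rightarrow> ratfun" where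
  "pullback_laurent \<phi> f =
     (\<Sum>v\<in>Poly_Mapping.keys f. Fract (Poly_Mapping.single 0 (Poly_Mapping.lookup f v)) 1 * \<phi> v)"

text \<open>The pullback of a rational function needs a representation whose denominator does not pull back
  to zero. For positive rational maps and quotients of positive Laurent polynomials there always is
  one, and the result does not depend on it.\<close>

definition pullback_ratfun :: "nat \<Rightarrow> (lattice \<Rightarrow> ratfun) \<Rightarrow> ratfun \<Rightarrow> ratfun" where
  "pullback_ratfun n2 \<phi> f = (THE g. \<exists>P\<in>laurents n2. \<exists>Q\<in>laurents n2. f = Fract P Q \<and>
     pullback_laurent \<phi> Q \<noteq> 0 \<and> g = pullback_laurent \<phi> P / pullback_laurent \<phi> Q)"

definition positively_birational :: "nat \<Rightarrow> nat \<Rightarrow> (lattice \<Rightarrow> ratfun) \<Rightarrow> bool" where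
  "positively_birational n1 n2 \<phi> \<longleftrightarrow> positive_rational_map n1 n2 \<phi> \<and>
     (\<exists>\<psi>. positive_rational_map n2 n1 \<psi> \<and>
        (\<forall>v\<in>lat n1. pullback_ratfun n2 \<phi> (\<psi> v) = Fract (Poly_Mapping.single v 1) 1) \<and>
        (\<forall>v\<in>lat n2. pullback_ratfun n1 \<psi> (\<phi> v) = Fract (Poly_Mapping.single v 1) 1))"

text \<open>The value at a positive point of a quotient of positive Laurent polynomials, independent of the
  positive representation.\<close>

definition ratfun_eval :: "nat \<Rightarrow> ratfun \<Rightarrow> (lattice \<Rightarrow> puiseux) \<Rightarrow> puiseux" where
  "ratfun_eval n f p = (THE c. \<exists>P Q. positive_laurent n P \<and> positive_laurent n Q \<and>
     f = Fract P Q \<and> c = laurent_eval P p / laurent_eval Q p)"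

definition map_points ::
  "nat \<Rightarrow> nat \<Rightarrow> (lattice \<Rightarrow> ratfun) \<Rightarrow> (lattice \<Rightarrow> puiseux) \<Rightarrow> lattice \<Rightarrow> puiseux" where
  "map_points n1 n2 \<phi> p = (\<lambda>v\<in>lat n2. ratfun_eval n1 (\<phi> v) p)"


section \<open>Tropicalisation\<close>

text \<open>\<open>Trop(T)\<close> is the quotient \<open>pos_points n // trop_rel n\<close>, with classes \<open>trop_class n x\<close>.\<close>

definition trop_rel :: "nat \<Rightarrow> ((lattice \<Rightarrow> puiseux) \<times> (lattice \<Rightarrow> puiseux)) set" where
  "trop_rel n = {(x, x'). x \<in> pos_points n \<and> x' \<in> pos_points n \<and>
     (\<forall>v\<in>lat n. pval (x v) = pval (x' v))}"

definition trop_class :: "nat \<Rightarrow> (lattice \<Rightarrow> puiseux) \<Rightarrow> (lattice \<Rightarrow> puiseux) set" where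
  "trop_class n x = trop_rel n `` {x}"

text \<open>The map induced on classes by \<open>x \<mapsto> [\<phi>(x)]\<close>: the union is over equal sets, cf.
  \<open>UN_equiv_class\<close>.\<close>

definition Trop_map ::
  "nat \<Rightarrow> nat \<Rightarrow> (lattice \<Rightarrow> ratfun) \<Rightarrow> (lattice \<Rightarrow> puiseux) set \<Rightarrow> (lattice \<Rightarrow> puiseux) set" where
  "Trop_map n1 n2 \<phi> d = (\<Union>x\<in>d. trop_class n2 (map_points n1 n2 \<phi> x))"

end

theory Submission
  imports Defs "HOL-Computational_Algebra.Formal_Power_Series"
begin

text \<open>Critical points: let \<open>\<psi>\<close> be the inverse of \<open>\<phi>\<close>, so that \<open>\<psi>\<^sup>*(W') = W\<close>. By the chain rule the logarithmic
  derivatives of \<open>W\<close> at \<open>q\<close> are linear combinations of those of \<open>W'\<close> at \<open>\<psi>(q)\<close>. Hence \<open>q\<close> is critical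
  for \<open>W\<close> if \<open>\<psi>(q)\<close> is critical for \<open>W'\<close>, and the converse holds by symmetry. The chain rule itself is
  only the statement that substituting an arc \<open>q exp(s u)\<close> with values in \<open>K[[s]]\<close> commutes with \<open>\<psi>\<close>.

  Completeness: if \<open>W'\<close> is not complete, the Farkas lemma gives a real direction \<open>x \<noteq> 0\<close> with
  \<open>\<langle>v, x\<rangle> \<ge> 0\<close> for all exponents \<open>v\<close> of \<open>W'\<close>. Along the points \<open>p\<^sub>s = t\<^bsup>s x\<^esup>\<close>, \<open>s \<ge> 0\<close>, the valuation of
  \<open>W'(p\<^sub>s) = W(\<phi>(p\<^sub>s))\<close> is bounded below. As \<open>W\<close> is complete, this bounds the valuations of \<open>\<phi>(p\<^sub>s)\<close>, and
  therefore those of \<open>p\<^sub>s = \<psi>(\<phi>(p\<^sub>s))\<close>, which is absurd for \<open>s \<rightarrow> \<infinity>\<close>.\<close>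

section \<open>Laurent polynomials and rational functions at points\<close>

lemma zero_in_lat: "0 \<in> lat n"
  by (simp add: lat_def)

lemma add_in_lat: "v \<in> lat n \<Longrightarrow> w \<in> lat n \<Longrightarrow> v + w \<in> lat n"
  using Poly_Mapping.keys_add[of v w] by (auto simp: lat_def)

lemma laurents_zero: "0 \<in> laurents n"
  by (simp add: laurents_def)

lemma laurents_single: "v \<in> lat n \<Longrightarrow> Poly_Mapping.single v c \<in> laurents n"
  by (simp add: laurents_def)

lemma laurents_one: "1 \<in> laurents n"
  by (simp add: laurents_def zero_in_lat)

lemma laurents_add: "f \<in> laurents n \<Longrightarrow> g \<in> laurents n \<Longrightarrow> f + g \<in> laurents n"
  using Poly_Mapping.keys_add[of f g] by (auto simp: laurents_def)

lemma laurents_mult: "f \<in> laurents n \<Longrightarrow> g \<in> laurents n \<Longrightarrow> f * g \<in> laurents n"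
  using Poly_Mapping.keys_mult[of f g] by (fastforce simp: laurents_def intro: add_in_lat)

lemma poly_mapping_sum_singles:
  "f = (\<Sum>v\<in>Poly_Mapping.keys f. Poly_Mapping.single v (Poly_Mapping.lookup f v))"
  by (rule poly_mapping_eqI)
     (simp add: lookup_sum lookup_single when_def in_keys_iff)

definition laurent_subst :: "(puiseux \<Rightarrow> 'r::idom) \<Rightarrow> (lattice \<Rightarrow> 'r) \<Rightarrow> laurent \<Rightarrow> 'r" where
  "laurent_subst \<kappa> p f = (\<Sum>v\<in>Poly_Mapping.keys f. \<kappa> (Poly_Mapping.lookup f v) * p v)"

text \<open>A relation instead of a function: \<open>'r\<close> need not have division, and a value
  exists only if some denominator does not vanish after substitution.\<close>

definition ratfun_value ::
  "nat \<Rightarrow> (puiseux \<Rightarrow> 'r::idom) \<Rightarrow> (lattice \<Rightarrow> 'r) \<Rightarrow> ratfun \<Rightarrow> 'r \<Rightarrow> bool" where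
  "ratfun_value n \<kappa> p f c \<longleftrightarrow> (\<exists>P\<in>laurents n. \<exists>Q\<in>laurents n. f = Fract P Q \<and>
     laurent_subst \<kappa> p Q \<noteq> 0 \<and> laurent_subst \<kappa> p P = c * laurent_subst \<kappa> p Q)"

lemma ratfun_valueI:
  assumes "P \<in> laurents n" "Q \<in> laurents n" "laurent_subst \<kappa> p Q \<noteq> 0"
    "laurent_subst \<kappa> p P = c * laurent_subst \<kappa> p Q"
  shows "ratfun_value n \<kappa> p (Fract P Q) c"
  using assms by (auto simp: ratfun_value_def)

text \<open>A point of the torus of rank \<open>n\<close> with values in a \<open>K\<close>-algebra that is an integral domain.
  Besides \<open>K\<close> itself, the ring of formal power series over \<open>K\<close> (arcs) and the
  function field of another torus (rational maps) occur.\<close>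

locale torus_point =
  fixes n :: nat and \<kappa> :: "puiseux \<Rightarrow> 'r::idom" and p :: "lattice \<Rightarrow> 'r"
  assumes coeff_add: "\<kappa> (a + b) = \<kappa> a + \<kappa> b"
    and coeff_mult: "\<kappa> (a * b) = \<kappa> a * \<kappa> b"
    and coeff_one: "\<kappa> 1 = 1"
    and char_zero: "p 0 = 1"
    and char_add: "v \<in> lat n \<Longrightarrow> w \<in> lat n \<Longrightarrow> p (v + w) = p v * p w"
begin

lemma coeff_zero: "\<kappa> 0 = 0"
  using coeff_add[of 0 0] by (metis add.right_neutral add_left_cancel)

lemma subst_superset:
  assumes "finite A" "Poly_Mapping.keys f \<subseteq> A"
  shows "laurent_subst \<kappa> p f = (\<Sum>v\<in>A. \<kappa> (Poly_Mapping.lookup f v) * p v)"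
  unfolding laurent_subst_def
  by (rule sum.mono_neutral_left) (use assms in \<open>auto simp: in_keys_iff coeff_zero\<close>)

lemma subst_add: "laurent_subst \<kappa> p (f + g) = laurent_subst \<kappa> p f + laurent_subst \<kappa> p g"
proof -
  let ?A = "Poly_Mapping.keys f \<union> Poly_Mapping.keys g"
  have "h \<in> {f, g, f + g} \<Longrightarrow>
      laurent_subst \<kappa> p h = (\<Sum>v\<in>?A. \<kappa> (Poly_Mapping.lookup h v) * p v)" for h
    by (rule subst_superset) (use Poly_Mapping.keys_add[of f g] in auto)
  then show ?thesis
    by (simp add: lookup_add coeff_add distrib_right sum.distrib)
qed

lemma subst_zero: "laurent_subst \<kappa> p 0 = 0"
  by (simp add: laurent_subst_def)

lemma subst_sum: "laurent_subst \<kappa> p (sum f A) = (\<Sum>a\<in>A. laurent_subst \<kappa> p (f a))"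
  by (induction A rule: infinite_finite_induct) (simp_all add: subst_zero subst_add)

lemma subst_single: "laurent_subst \<kappa> p (Poly_Mapping.single v c) = \<kappa> c * p v"
  by (simp add: laurent_subst_def coeff_zero)

lemma subst_one: "laurent_subst \<kappa> p 1 = 1"
  using subst_single[of 0 1] by (simp add: coeff_one char_zero)

text \<open>On monomials this is \<open>char_add\<close>, which is available only on
  \<open>lat n\<close>; hence the restriction to \<open>laurents n\<close>.\<close>

lemma subst_mult:
  assumes "f \<in> laurents n" "g \<in> laurents n"
  shows "laurent_subst \<kappa> p (f * g) = laurent_subst \<kappa> p f * laurent_subst \<kappa> p g"
proof -
  let ?s = "\<lambda>h v. Poly_Mapping.single v (Poly_Mapping.lookup h v)"
  have "f * g = (\<Sum>v\<in>Poly_Mapping.keys f. ?s f v) * (\<Sum>w\<in>Poly_Mapping.keys g. ?s g w)"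
    using poly_mapping_sum_singles[of f] poly_mapping_sum_singles[of g] by metis
  also have "\<dots> = (\<Sum>v\<in>Poly_Mapping.keys f. \<Sum>w\<in>Poly_Mapping.keys g.
      Poly_Mapping.single (v + w) (Poly_Mapping.lookup f v * Poly_Mapping.lookup g w))"
    by (simp add: sum_product mult_single)
  also have "laurent_subst \<kappa> p \<dots> = (\<Sum>v\<in>Poly_Mapping.keys f. \<Sum>w\<in>Poly_Mapping.keys g.
      (\<kappa> (Poly_Mapping.lookup f v) * p v) * (\<kappa> (Poly_Mapping.lookup g w) * p w))"
    unfolding subst_sum subst_single
    using assms by (intro sum.cong refl) (auto simp: laurents_def char_add subsetD coeff_mult ac_simps)
  finally show ?thesis
    unfolding laurent_subst_def by (simp add: sum_product)
qed

lemma subst_nonzero: "laurent_subst \<kappa> p f \<noteq> 0 \<Longrightarrow> f \<noteq> 0"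
  using subst_zero by auto

text \<open>Equal fractions cross-multiply to an identity of Laurent polynomials, which survives
  substitution; the nonzero denominators then cancel in the domain \<open>'r\<close>.\<close>

lemma ratfun_value_unique:
  assumes "ratfun_value n \<kappa> p f c" "ratfun_value n \<kappa> p f d" shows "c = d"
proof -
  let ?h = "laurent_subst \<kappa> p"
  obtain P Q where PQ: "P \<in> laurents n" "Q \<in> laurents n" "f = Fract P Q" "?h Q \<noteq> 0" "?h P = c * ?h Q"
    using assms(1) by (auto simp: ratfun_value_def)
  obtain R S where RS: "R \<in> laurents n" "S \<in> laurents n" "f = Fract R S" "?h S \<noteq> 0" "?h R = d * ?h S"
    using assms(2) by (auto simp: ratfun_value_def)
  have "P * S = R * Q"
    using PQ RS subst_nonzero by (metis eq_fract(1))
  then have "?h P * ?h S = ?h R * ?h Q"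
    using PQ RS by (metis subst_mult)
  then show ?thesis using PQ RS by simp
qed

lemma ratfun_value_Fract_one: "f \<in> laurents n \<Longrightarrow> ratfun_value n \<kappa> p (Fract f 1) (laurent_subst \<kappa> p f)"
  by (rule ratfun_valueI) (simp_all add: laurents_one subst_one)

lemma ratfun_value_single:
  "v \<in> lat n \<Longrightarrow> ratfun_value n \<kappa> p (Fract (Poly_Mapping.single v c) 1) (\<kappa> c * p v)"
  using ratfun_value_Fract_one[OF laurents_single] by (simp add: subst_single)

lemma ratfun_value_zero: "ratfun_value n \<kappa> p 0 0"
  using ratfun_value_Fract_one[OF laurents_zero] by (simp add: Zero_fract_def subst_zero)

lemma ratfun_value_one: "ratfun_value n \<kappa> p 1 1"
  using ratfun_value_Fract_one[OF laurents_one] by (simp add: One_fract_def subst_one)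

lemma ratfun_value_add:
  assumes "ratfun_value n \<kappa> p f c" "ratfun_value n \<kappa> p g d"
  shows "ratfun_value n \<kappa> p (f + g) (c + d)"
proof -
  let ?h = "laurent_subst \<kappa> p"
  obtain P Q where PQ: "P \<in> laurents n" "Q \<in> laurents n" "f = Fract P Q" "?h Q \<noteq> 0" "?h P = c * ?h Q"
    using assms(1) by (auto simp: ratfun_value_def)
  obtain R S where RS: "R \<in> laurents n" "S \<in> laurents n" "g = Fract R S" "?h S \<noteq> 0" "?h R = d * ?h S"
    using assms(2) by (auto simp: ratfun_value_def)
  have "f + g = Fract (P * S + R * Q) (Q * S)"
    using PQ RS subst_nonzero by simp
  also have "ratfun_value n \<kappa> p \<dots> (c + d)"
    by (rule ratfun_valueI)
       (use PQ RS in \<open>simp_all add: laurents_add laurents_mult subst_add subst_mult algebra_simps\<close>)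
  finally show ?thesis .
qed

lemma ratfun_value_mult:
  assumes "ratfun_value n \<kappa> p f c" "ratfun_value n \<kappa> p g d"
  shows "ratfun_value n \<kappa> p (f * g) (c * d)"
proof -
  let ?h = "laurent_subst \<kappa> p"
  obtain P Q where PQ: "P \<in> laurents n" "Q \<in> laurents n" "f = Fract P Q" "?h Q \<noteq> 0" "?h P = c * ?h Q"
    using assms(1) by (auto simp: ratfun_value_def)
  obtain R S where RS: "R \<in> laurents n" "S \<in> laurents n" "g = Fract R S" "?h S \<noteq> 0" "?h R = d * ?h S"
    using assms(2) by (auto simp: ratfun_value_def)
  have "f * g = Fract (P * R) (Q * S)"
    using PQ RS by simp
  also have "ratfun_value n \<kappa> p \<dots> (c * d)"
    by (rule ratfun_valueI)
       (use PQ RS in \<open>simp_all add: laurents_mult subst_mult algebra_simps\<close>)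
  finally show ?thesis .
qed

text \<open>Stands in for division of values, which \<open>'r\<close> may lack. As \<open>d\<close>
  is nonzero, the numerator of \<open>g\<close> has nonzero value and may serve as a
  denominator.\<close>

lemma ratfun_value_cancel:
  assumes "ratfun_value n \<kappa> p (f * g) (c * d)" "ratfun_value n \<kappa> p g d" "d \<noteq> 0"
  shows "ratfun_value n \<kappa> p f c"
proof -
  let ?h = "laurent_subst \<kappa> p"
  obtain P Q where PQ: "P \<in> laurents n" "Q \<in> laurents n" "f * g = Fract P Q" "?h Q \<noteq> 0" "?h P = c * d * ?h Q"
    using assms(1) by (auto simp: ratfun_value_def)
  obtain R S where RS: "R \<in> laurents n" "S \<in> laurents n" "g = Fract R S" "?h S \<noteq> 0" "?h R = d * ?h S"
    using assms(2) by (auto simp: ratfun_value_def)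
  have R: "?h R \<noteq> 0" using RS assms(3) by simp
  then have "g \<noteq> 0"
    using RS subst_nonzero[of R] subst_nonzero[of S] by (simp add: Zero_fract_def eq_fract)
  then have "f = f * g / g" by simp
  also have "\<dots> = Fract (P * S) (Q * R)"
    unfolding PQ(3) by (simp add: RS(3))
  also have "ratfun_value n \<kappa> p \<dots> c"
    by (rule ratfun_valueI)
       (use PQ RS R in \<open>simp_all add: laurents_mult subst_mult algebra_simps\<close>)
  finally show ?thesis .
qed

lemma ratfun_value_sum:
  assumes "\<And>a. a \<in> A \<Longrightarrow> ratfun_value n \<kappa> p (f a) (c a)"
  shows "ratfun_value n \<kappa> p (sum f A) (sum c A)"
  using assms
  by (induction A rule: infinite_finite_induct) (simp_all add: ratfun_value_zero ratfun_value_add)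

lemma ratfun_value_pullback_laurent:
  assumes "\<And>v. v \<in> lat m \<Longrightarrow> ratfun_value n \<kappa> p (\<phi> v) (q v)" "f \<in> laurents m"
  shows "ratfun_value n \<kappa> p (pullback_laurent \<phi> f) (laurent_subst \<kappa> q f)"
  unfolding pullback_laurent_def laurent_subst_def
proof (intro ratfun_value_sum ratfun_value_mult)
  fix v assume "v \<in> Poly_Mapping.keys f"
  then show "ratfun_value n \<kappa> p (\<phi> v) (q v)" using assms by (auto simp: laurents_def)
  show "ratfun_value n \<kappa> p (Fract (Poly_Mapping.single 0 (Poly_Mapping.lookup f v)) 1)
      (\<kappa> (Poly_Mapping.lookup f v))"
    using ratfun_value_single[OF zero_in_lat] by (simp add: char_zero)
qed

end

section \<open>Rational maps as points over a function field\<close>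

lemma rational_map_zero: "rational_map n1 n2 \<phi> \<Longrightarrow> \<phi> 0 = 1"
  unfolding rational_map_def using zero_in_lat by (metis add_0 mult_cancel_right1)

abbreviation const_ratfun :: "puiseux \<Rightarrow> ratfun" where
  "const_ratfun c \<equiv> Fract (Poly_Mapping.single 0 c) 1"

abbreviation char_ratfun :: "lattice \<Rightarrow> ratfun" where
  "char_ratfun v \<equiv> Fract (Poly_Mapping.single v 1) 1"

lemma pullback_laurent_eq_subst: "pullback_laurent \<phi> = laurent_subst const_ratfun \<phi>"
  by (simp add: fun_eq_iff pullback_laurent_def laurent_subst_def)

text \<open>A rational map is a point of the target torus over the function field of the source, so
  pullback is itself a substitution and the rules for values apply to it.\<close>

lemma torus_point_rational_map:
  assumes "rational_map n1 n2 \<phi>" shows "torus_point n2 const_ratfun \<phi>"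
proof
  show "\<phi> 0 = 1" by (rule rational_map_zero[OF assms])
  show "\<phi> (v + w) = \<phi> v * \<phi> w" if "v \<in> lat n2" "w \<in> lat n2" for v w
    using assms that by (simp add: rational_map_def)
qed (simp_all add: single_add mult_single One_fract_def)

text \<open>The characters form the generic point of the torus, which is what the composite of a map
  with its inverse amounts to.\<close>

lemma laurent_subst_char_ratfun: "laurent_subst const_ratfun char_ratfun f = Fract f 1"
proof -
  have "Fract (sum g A) 1 = (\<Sum>a\<in>A. Fract (g a) 1)" if "finite A" for g :: "lattice \<Rightarrow> laurent" and A
    using that
  proof (induction A)
    case (insert a A)
    show ?case unfolding sum.insert[OF insert.hyps] insert.IH[symmetric] by simp
  qed (simp add: Zero_fract_def)
  from this[of "Poly_Mapping.keys f" "\<lambda>v. Poly_Mapping.single v (Poly_Mapping.lookup f v)"]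
  show ?thesis
    by (simp add: laurent_subst_def mult_single flip: poly_mapping_sum_singles)
qed

text \<open>Multiplicativity of \<open>\<phi>\<close> passes to \<open>q\<close> because both sides
  are values of the same rational function at \<open>p\<close>, and values are unique.\<close>

lemma (in torus_point) torus_point_image:
  assumes "rational_map n m \<phi>" "\<And>v. v \<in> lat m \<Longrightarrow> ratfun_value n \<kappa> p (\<phi> v) (q v)"
  shows "torus_point m \<kappa> q"
proof
  show "q 0 = 1"
    using ratfun_value_unique[OF assms(2)[OF zero_in_lat]] ratfun_value_one
    by (simp add: rational_map_zero[OF assms(1)])
  show "q (v + w) = q v * q w" if "v \<in> lat m" "w \<in> lat m" for v w
  proof (rule ratfun_value_unique)
    show "ratfun_value n \<kappa> p (\<phi> (v + w)) (q v * q w)"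
      using assms that by (simp add: rational_map_def ratfun_value_mult)
  qed (use assms that add_in_lat in blast)
qed (simp_all add: coeff_add coeff_mult coeff_one)

text \<open>Composition law: \<open>q\<close> is the image of \<open>p\<close>, and \<open>g\<close>
  the pullback of \<open>f\<close>. The representations of \<open>f\<close> behind the two
  assumptions may differ; uniqueness of values over the function field reconciles them.\<close>

lemma (in torus_point) ratfun_value_pullback:
  assumes \<phi>: "rational_map n m \<phi>" and q: "\<And>v. v \<in> lat m \<Longrightarrow> ratfun_value n \<kappa> p (\<phi> v) (q v)"
    and f: "ratfun_value m \<kappa> q f c" "ratfun_value m const_ratfun \<phi> f g"
  shows "ratfun_value n \<kappa> p g c"
proof -
  interpret \<phi>: torus_point m const_ratfun \<phi> by (rule torus_point_rational_map[OF \<phi>])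
  obtain P Q where PQ: "P \<in> laurents m" "Q \<in> laurents m" "f = Fract P Q"
      "laurent_subst \<kappa> q Q \<noteq> 0" "laurent_subst \<kappa> q P = c * laurent_subst \<kappa> q Q"
    using f(1) by (auto simp: ratfun_value_def)
  have pull: "ratfun_value n \<kappa> p (pullback_laurent \<phi> h) (laurent_subst \<kappa> q h)" if "h \<in> laurents m" for h
    by (rule ratfun_value_pullback_laurent[OF q that])
  \<comment> \<open>The value of this pullback at \<open>p\<close> is that of \<open>Q\<close> at
    \<open>q\<close>, which is nonzero, whereas the zero function has value zero.\<close>
  have "pullback_laurent \<phi> Q \<noteq> 0"
    using ratfun_value_unique[OF pull[OF PQ(2)]] ratfun_value_zero PQ(4) by metis
  then have "ratfun_value m const_ratfun \<phi> f (pullback_laurent \<phi> P / pullback_laurent \<phi> Q)"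
    unfolding PQ(3) using PQ by (intro ratfun_valueI) (simp_all add: pullback_laurent_eq_subst)
  then have "pullback_laurent \<phi> P = g * pullback_laurent \<phi> Q"
    using \<phi>.ratfun_value_unique[OF f(2)] \<open>pullback_laurent \<phi> Q \<noteq> 0\<close> by simp
  then show ?thesis
    using ratfun_value_cancel[of g "pullback_laurent \<phi> Q" c] pull[OF PQ(1)] pull[OF PQ(2)] PQ by simp
qed

section \<open>Positive Puiseux series\<close>

lemma pval_eqI:
  assumes "pcoeff f m \<noteq> 0" "\<And>x. x < m \<Longrightarrow> pcoeff f x = 0" shows "pval f = m"
  unfolding pval_def using assms by (intro Least_equality) (auto simp: not_less[symmetric])

lemma pcoeff_pval:
  assumes "f \<noteq> 0"
  shows "pcoeff f (pval f) \<noteq> 0" and "x < pval f \<Longrightarrow> pcoeff f x = 0"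
proof -
  have "{x. pcoeff f x \<noteq> 0} \<noteq> {}"
    using assms by (auto simp: pcoeff_inject[symmetric] zero_puiseux.rep_eq fun_eq_iff)
  then obtain m where m: "pcoeff f m \<noteq> 0" "\<forall>y\<in>{x. pcoeff f x \<noteq> 0}. m \<le> y"
    using loc_finite_least[of "pcoeff f", OF _ subset_refl] pcoeff[of f] by auto
  then have "pval f = m" by (intro pval_eqI) force+
  then show "pcoeff f (pval f) \<noteq> 0" "x < pval f \<Longrightarrow> pcoeff f x = 0" using m by force+
qed

lemma KposI:
  assumes "pcoeff f m = of_real r" "r > 0" "\<And>x. x < m \<Longrightarrow> pcoeff f x = 0"
  shows "f \<in> Kpos" and "pval f = m"
proof -
  show m: "pval f = m" using assms by (intro pval_eqI) auto
  have "f \<noteq> 0" using assms by (auto simp: zero_puiseux.rep_eq)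
  then show "f \<in> Kpos" using assms m by (auto simp: Kpos_def)
qed

lemma KposE:
  assumes "f \<in> Kpos"
  obtains r where "r > 0" "pcoeff f (pval f) = of_real r" "\<And>x. x < pval f \<Longrightarrow> pcoeff f x = 0"
  using assms pcoeff_pval(2) by (auto simp: Kpos_def)

lemma Kpos_nonzero: "f \<in> Kpos \<Longrightarrow> f \<noteq> 0"
  by (simp add: Kpos_def)

text \<open>The only pair of exponents with sum \<open>m + k\<close> that can contribute is
  \<open>m\<close> and \<open>k\<close>.\<close>

lemma pcoeff_times_lowest:
  assumes "\<And>x. x < m \<Longrightarrow> pcoeff f x = 0" "\<And>x. x < k \<Longrightarrow> pcoeff g x = 0"
  shows "pcoeff (f * g) (m + k) = pcoeff f m * pcoeff g k"
proof -
  have "conv (pcoeff f) (pcoeff g) (m + k) = (\<Sum>a\<in>{m}. pcoeff f a * pcoeff g (m + k - a))"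
    unfolding conv_def
  proof (rule sum.mono_neutral_left)
    show "{a. pcoeff f a \<noteq> 0 \<and> pcoeff g (m + k - a) \<noteq> 0} \<subseteq> {m}"
    proof
      fix a assume "a \<in> {a. pcoeff f a \<noteq> 0 \<and> pcoeff g (m + k - a) \<noteq> 0}"
      then have "\<not> a < m" "\<not> m + k - a < k" using assms by blast+
      then show "a \<in> {m}" by simp
    qed
  qed auto
  then show ?thesis by (simp add: times_puiseux.rep_eq)
qed

lemma Kpos_mult:
  assumes "f \<in> Kpos" "g \<in> Kpos"
  shows "f * g \<in> Kpos" and "pval (f * g) = pval f + pval g"
proof -
  obtain r where r: "r > 0" "pcoeff f (pval f) = of_real r" "\<And>x. x < pval f \<Longrightarrow> pcoeff f x = 0"
    using KposE[OF assms(1)] by metis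
  obtain s where s: "s > 0" "pcoeff g (pval g) = of_real s" "\<And>x. x < pval g \<Longrightarrow> pcoeff g x = 0"
    using KposE[OF assms(2)] by metis
  have "pcoeff (f * g) (pval f + pval g) = of_real (r * s)"
    using pcoeff_times_lowest[OF r(3) s(3)] r s by simp
  moreover have "pcoeff (f * g) x = 0" if "x < pval f + pval g" for x
    using pcoeff_times_below[OF r(3) s(3) that] .
  ultimately show "f * g \<in> Kpos" "pval (f * g) = pval f + pval g"
    using KposI[of "f * g" _ "r * s"] r s by simp_all
qed

lemma Kpos_one: "1 \<in> Kpos"
  using KposI(1)[of 1 0 1] by (simp add: one_puiseux.rep_eq)

text \<open>Comparing lowest terms in \<open>f * inverse f = 1\<close> forces the leading
  coefficients to be inverse to each other.\<close>

lemma Kpos_inverse: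
  assumes "f \<in> Kpos" shows "inverse f \<in> Kpos"
proof -
  obtain r where r: "r > 0" "pcoeff f (pval f) = of_real r" "\<And>x. x < pval f \<Longrightarrow> pcoeff f x = 0"
    using KposE[OF assms] by metis
  let ?g = "inverse f"
  have g: "?g \<noteq> 0" "f * ?g = 1" using Kpos_nonzero[OF assms] by simp_all
  have eq: "pcoeff 1 (pval f + pval ?g) = of_real r * pcoeff ?g (pval ?g)"
    using pcoeff_times_lowest[OF r(3) pcoeff_pval(2)[OF g(1)]] r g by simp
  also have "\<dots> \<noteq> 0" using r pcoeff_pval(1)[OF g(1)] by simp
  finally have "pval f + pval ?g = 0" by (simp add: one_puiseux.rep_eq split: if_splits)
  then have "of_real r * pcoeff ?g (pval ?g) = 1"
    using eq by (simp add: one_puiseux.rep_eq)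
  then have "pcoeff ?g (pval ?g) = of_real (inverse r)"
    using r(1) by (simp add: field_simps)
  then show ?thesis using KposI(1) r(1) pcoeff_pval(2)[OF g(1)] by (metis positive_imp_inverse_positive)
qed

lemma Kpos_divide:
  assumes "f \<in> Kpos" "g \<in> Kpos"
  shows "f / g \<in> Kpos" and "pval (f / g) = pval f - pval g"
proof -
  show fg: "f / g \<in> Kpos" using assms Kpos_mult(1) Kpos_inverse by (simp add: divide_inverse)
  show "pval (f / g) = pval f - pval g"
    using Kpos_mult(2)[OF fg assms(2)] Kpos_nonzero[OF assms(2)] by simp
qed

text \<open>Leading coefficients are positive reals, so they cannot cancel even if the valuations
  agree. The minimum is therefore exact and not only a lower bound; the tropical arguments rest on
  this.\<close>

lemma Kpos_add:
  assumes "f \<in> Kpos" "g \<in> Kpos"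
  shows "f + g \<in> Kpos" and "pval (f + g) = min (pval f) (pval g)"
proof -
  obtain r where r: "r > 0" "pcoeff f (pval f) = of_real r" "\<And>x. x < pval f \<Longrightarrow> pcoeff f x = 0"
    using KposE[OF assms(1)] by metis
  obtain s where s: "s > 0" "pcoeff g (pval g) = of_real s" "\<And>x. x < pval g \<Longrightarrow> pcoeff g x = 0"
    using KposE[OF assms(2)] by metis
  define m where "m = min (pval f) (pval g)"
  have "\<exists>c>0. pcoeff (f + g) m = of_real c"
  proof -
    consider "pval f < pval g" | "pval g < pval f" | "pval f = pval g" by linarith
    then show ?thesis
    proof cases
      case 3
      then show ?thesis using r s by (intro exI[of _ "r + s"]) (simp add: m_def plus_puiseux.rep_eq)
    qed (use r s in \<open>auto simp: m_def plus_puiseux.rep_eq\<close>)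
  qed
  moreover have "pcoeff (f + g) x = 0" if "x < m" for x
    using r(3) s(3) that by (simp add: m_def plus_puiseux.rep_eq)
  ultimately show "f + g \<in> Kpos" "pval (f + g) = min (pval f) (pval g)"
    using KposI unfolding m_def by metis+
qed

lemma Kpos_sum:
  assumes "finite A" "A \<noteq> {}" "\<And>a. a \<in> A \<Longrightarrow> f a \<in> Kpos"
  shows "sum f A \<in> Kpos" and "pval (sum f A) = Min ((\<lambda>a. pval (f a)) ` A)"
proof -
  have "sum f A \<in> Kpos \<and> pval (sum f A) = Min ((\<lambda>a. pval (f a)) ` A)"
    using assms
  proof (induction A rule: finite_ne_induct)
    case (insert a A)
    then show ?case using Kpos_add[of "f a" "sum f A"] by simp
  qed simp
  then show "sum f A \<in> Kpos" "pval (sum f A) = Min ((\<lambda>a. pval (f a)) ` A)" by auto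
qed

text \<open>The monomial \<open>t^a\<close>, used to build points with prescribed
  valuations.\<close>

definition puiseux_monom :: "real \<Rightarrow> puiseux" where
  "puiseux_monom a = Abs_puiseux (\<lambda>x. if x = a then 1 else 0)"

lemma pcoeff_puiseux_monom: "pcoeff (puiseux_monom a) x = (if x = a then 1 else 0)"
proof -
  have "loc_finite (\<lambda>x. if x = a then 1 else 0)"
    unfolding loc_finite_def by (rule allI, rule finite_subset[of _ "{a}"]) auto
  then show ?thesis by (simp add: puiseux_monom_def Abs_puiseux_inverse)
qed

lemma Kpos_puiseux_monom: "puiseux_monom a \<in> Kpos"
  and pval_puiseux_monom: "pval (puiseux_monom a) = a"
  using KposI[of "puiseux_monom a" a 1] by (simp_all add: pcoeff_puiseux_monom)

lemma puiseux_monom_add: "puiseux_monom (a + b) = puiseux_monom a * puiseux_monom b"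
proof -
  have "{c. (if c = a then 1 else 0 :: complex) \<noteq> 0 \<and> (if x - c = b then 1 else 0 :: complex) \<noteq> 0}
      = (if x = a + b then {a} else {})" for x
    by auto
  then show ?thesis
    by (simp add: pcoeff_inject[symmetric] fun_eq_iff times_puiseux.rep_eq pcoeff_puiseux_monom conv_def)
qed

text \<open>Characteristic zero gives the functional equation of \<open>fps_exp\<close> over this
  field.\<close>

instance puiseux :: field_char_0
proof
  have "pcoeff (of_nat k) 0 = of_nat k" for k
    by (induction k) (simp_all add: zero_puiseux.rep_eq one_puiseux.rep_eq plus_puiseux.rep_eq)
  then show "inj (of_nat :: nat \<Rightarrow> puiseux)" by (metis injI of_nat_eq_iff)
qed

section \<open>Positive points and positive rational maps\<close>

lemma laurent_eval_eq_subst: "laurent_eval f p = laurent_subst (\<lambda>c. c) p f"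
  by (simp add: laurent_eval_def laurent_subst_def)

lemma pos_points_Kpos: "p \<in> pos_points n \<Longrightarrow> v \<in> lat n \<Longrightarrow> p v \<in> Kpos"
  by (auto simp: pos_points_def)

lemma torus_point_pos_point:
  assumes "p \<in> pos_points n" shows "torus_point n (\<lambda>c. c) p"
proof
  show "p (v + w) = p v * p w" if "v \<in> lat n" "w \<in> lat n" for v w
    using assms that by (auto simp: pos_points_def)
  from this[OF zero_in_lat zero_in_lat] show "p 0 = 1"
    using Kpos_nonzero[OF pos_points_Kpos[OF assms zero_in_lat]] by simp
qed simp_all

text \<open>A sum of positive terms has no cancellation, so its valuation is the tropical polynomial
  of \<open>P\<close> at the valuations of \<open>p\<close>.\<close>

lemma laurent_eval_Kpos:
  assumes "positive_laurent n P" "p \<in> pos_points n"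
  shows "laurent_eval P p \<in> Kpos"
    and "pval (laurent_eval P p) =
      Min ((\<lambda>v. pval (Poly_Mapping.lookup P v) + pval (p v)) ` Poly_Mapping.keys P)"
proof -
  have K: "Poly_Mapping.lookup P v \<in> Kpos" "p v \<in> Kpos" if "v \<in> Poly_Mapping.keys P" for v
    using assms that by (auto simp: positive_laurent_def laurents_def intro: pos_points_Kpos)
  have P: "finite (Poly_Mapping.keys P)" "Poly_Mapping.keys P \<noteq> {}"
    using assms by (simp_all add: positive_laurent_def)
  show "laurent_eval P p \<in> Kpos"
    unfolding laurent_eval_def using P K by (intro Kpos_sum(1) Kpos_mult(1)) auto
  show "pval (laurent_eval P p) =
      Min ((\<lambda>v. pval (Poly_Mapping.lookup P v) + pval (p v)) ` Poly_Mapping.keys P)"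
    unfolding laurent_eval_def using P K
    by (subst Kpos_sum(2)) (auto intro: Kpos_mult(1) simp: Kpos_mult(2) cong: image_cong)
qed

lemma positive_rational_map_rational: "positive_rational_map n m \<phi> \<Longrightarrow> rational_map n m \<phi>"
  by (simp add: positive_rational_map_def)

lemma positive_rational_mapE:
  assumes "positive_rational_map n m \<phi>" "v \<in> lat m"
  obtains P Q where "positive_laurent n P" "positive_laurent n Q" "\<phi> v = Fract P Q"
  using assms unfolding positive_rational_map_def by blast

lemma positive_laurent_laurents: "positive_laurent n P \<Longrightarrow> P \<in> laurents n"
  by (simp add: positive_laurent_def)

text \<open>Positive denominators do not vanish at positive points, so every positive representation
  yields a value; uniqueness of values settles the description in
  \<open>ratfun_eval\<close>.\<close>

lemma ratfun_eval_Fract: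
  assumes p: "p \<in> pos_points n" and PQ: "positive_laurent n P" "positive_laurent n Q"
  shows "ratfun_eval n (Fract P Q) p = laurent_eval P p / laurent_eval Q p"
    and "ratfun_value n (\<lambda>c. c) p (Fract P Q) (laurent_eval P p / laurent_eval Q p)"
proof -
  interpret torus_point n "\<lambda>c. c" p by (rule torus_point_pos_point[OF p])
  have val: "ratfun_value n (\<lambda>c. c) p (Fract R S) (laurent_eval R p / laurent_eval S p)"
    if "positive_laurent n R" "positive_laurent n S" for R S
    using that Kpos_nonzero[OF laurent_eval_Kpos(1)[OF that(2) p]]
    by (intro ratfun_valueI) (simp_all add: laurent_eval_eq_subst positive_laurent_laurents)
  show "ratfun_value n (\<lambda>c. c) p (Fract P Q) (laurent_eval P p / laurent_eval Q p)"
    by (rule val[OF PQ])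
  show "ratfun_eval n (Fract P Q) p = laurent_eval P p / laurent_eval Q p"
    unfolding ratfun_eval_def
  proof (rule the_equality)
    fix c assume "\<exists>R S. positive_laurent n R \<and> positive_laurent n S \<and>
      Fract P Q = Fract R S \<and> c = laurent_eval R p / laurent_eval S p"
    then show "c = laurent_eval P p / laurent_eval Q p"
      using val[OF PQ] val ratfun_value_unique by metis
  qed (use PQ in blast)
qed

lemma map_points_value:
  assumes \<phi>: "positive_rational_map n m \<phi>" and p: "p \<in> pos_points n" and v: "v \<in> lat m"
  shows "ratfun_value n (\<lambda>c. c) p (\<phi> v) (map_points n m \<phi> p v)"
    and "map_points n m \<phi> p v \<in> Kpos"
proof -
  obtain P Q where PQ: "positive_laurent n P" "positive_laurent n Q" "\<phi> v = Fract P Q"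
    using positive_rational_mapE[OF \<phi> v] .
  have "map_points n m \<phi> p v = laurent_eval P p / laurent_eval Q p"
    using v ratfun_eval_Fract(1)[OF p PQ(1,2)] by (simp add: map_points_def PQ(3))
  then show "ratfun_value n (\<lambda>c. c) p (\<phi> v) (map_points n m \<phi> p v)" "map_points n m \<phi> p v \<in> Kpos"
    using ratfun_eval_Fract(2)[OF p PQ(1,2)] laurent_eval_Kpos(1) Kpos_divide(1) PQ p by auto
qed

lemma map_points_pos_points:
  assumes \<phi>: "positive_rational_map n m \<phi>" and p: "p \<in> pos_points n"
  shows "map_points n m \<phi> p \<in> pos_points m"
proof -
  interpret torus_point n "\<lambda>c. c" p by (rule torus_point_pos_point[OF p])
  interpret q: torus_point m "\<lambda>c. c" "map_points n m \<phi> p"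
    by (rule torus_point_image[OF positive_rational_map_rational[OF \<phi>] map_points_value(1)[OF \<phi> p]])
  have "map_points n m \<phi> p \<in> extensional (lat m)" by (simp add: map_points_def)
  then show ?thesis
    using map_points_value(2)[OF \<phi> p] q.char_add by (auto simp: pos_points_def PiE_def)
qed

lemma pos_points_one: "(\<lambda>v\<in>lat n. 1) \<in> pos_points n"
  by (auto simp: pos_points_def Kpos_one add_in_lat)

text \<open>Testing at the identity point, where all characters are 1, is enough: there the pullback
  takes the value of \<open>Q\<close> at a positive point, which lies in
  \<open>Kpos\<close>.\<close>

lemma pullback_laurent_nonzero:
  assumes \<phi>: "positive_rational_map n m \<phi>" and Q: "positive_laurent m Q"
  shows "pullback_laurent \<phi> Q \<noteq> 0"
proof -
  let ?p = "\<lambda>v\<in>lat n. 1"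
  interpret torus_point n "\<lambda>c. c" ?p by (rule torus_point_pos_point[OF pos_points_one])
  have "ratfun_value n (\<lambda>c. c) ?p (pullback_laurent \<phi> Q) (laurent_eval Q (map_points n m \<phi> ?p))"
    unfolding laurent_eval_eq_subst
    by (rule ratfun_value_pullback_laurent[OF map_points_value(1)[OF \<phi> pos_points_one]])
       (use Q in \<open>auto simp: positive_laurent_laurents\<close>)
  then show ?thesis
    using ratfun_value_unique ratfun_value_zero
      Kpos_nonzero[OF laurent_eval_Kpos(1)[OF Q map_points_pos_points[OF \<phi> pos_points_one]]]
    by metis
qed

lemma pullback_ratfun_value:
  assumes \<phi>: "positive_rational_map n m \<phi>" and PQ: "positive_laurent m P" "positive_laurent m Q"
  shows "ratfun_value m const_ratfun \<phi> (Fract P Q) (pullback_ratfun m \<phi> (Fract P Q))"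
proof -
  interpret torus_point m const_ratfun \<phi>
    by (rule torus_point_rational_map[OF positive_rational_map_rational[OF \<phi>]])
  let ?f = "Fract P Q" and ?g = "pullback_laurent \<phi> P / pullback_laurent \<phi> Q"
  \<comment> \<open>Over a field the division-free relation is the quotient in
    \<open>pullback_ratfun\<close>, so uniqueness of values settles the description there.\<close>
  have iff: "ratfun_value m const_ratfun \<phi> ?f g \<longleftrightarrow> (\<exists>P\<in>laurents m. \<exists>Q\<in>laurents m. ?f = Fract P Q \<and>
     pullback_laurent \<phi> Q \<noteq> 0 \<and> g = pullback_laurent \<phi> P / pullback_laurent \<phi> Q)" for g
    unfolding ratfun_value_def pullback_laurent_eq_subst[symmetric]
    by (intro bex_cong refl) (auto simp: field_simps)
  have val: "ratfun_value m const_ratfun \<phi> ?f ?g"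
    using PQ pullback_laurent_nonzero[OF \<phi> PQ(2)]
    by (intro ratfun_valueI) (simp_all add: positive_laurent_laurents flip: pullback_laurent_eq_subst)
  have "pullback_ratfun m \<phi> ?f = ?g"
    unfolding pullback_ratfun_def iff[symmetric]
    using val ratfun_value_unique[OF _ val] by (intro the_equality)
  then show ?thesis using val by simp
qed

section \<open>Mutually inverse positive rational maps\<close>

text \<open>Birationality with the inverse named and the value relation in place of definite
  descriptions. The condition is symmetric, so results can be used in both directions.\<close>

definition inverse_rational_maps :: "nat \<Rightarrow> nat \<Rightarrow> (lattice \<Rightarrow> ratfun) \<Rightarrow> (lattice \<Rightarrow> ratfun) \<Rightarrow> bool" where
  "inverse_rational_maps n1 n2 \<phi> \<psi> \<longleftrightarrow> positive_rational_map n1 n2 \<phi> \<and> positive_rational_map n2 n1 \<psi> \<and>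
     (\<forall>v\<in>lat n1. ratfun_value n2 const_ratfun \<phi> (\<psi> v) (char_ratfun v)) \<and>
     (\<forall>v\<in>lat n2. ratfun_value n1 const_ratfun \<psi> (\<phi> v) (char_ratfun v))"

lemma inverse_rational_maps_sym:
  "inverse_rational_maps n1 n2 \<phi> \<psi> \<Longrightarrow> inverse_rational_maps n2 n1 \<psi> \<phi>"
  by (simp add: inverse_rational_maps_def)

lemma positively_birationalE:
  assumes "positively_birational n1 n2 \<phi>"
  obtains \<psi> where "inverse_rational_maps n1 n2 \<phi> \<psi>"
proof -
  obtain \<psi> where \<psi>: "positive_rational_map n1 n2 \<phi>" "positive_rational_map n2 n1 \<psi>"
      "\<forall>v\<in>lat n1. pullback_ratfun n2 \<phi> (\<psi> v) = char_ratfun v"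
      "\<forall>v\<in>lat n2. pullback_ratfun n1 \<psi> (\<phi> v) = char_ratfun v"
    using assms unfolding positively_birational_def by blast
  have "ratfun_value n2 const_ratfun \<phi> (\<psi> v) (char_ratfun v)" if v: "v \<in> lat n1" for v
  proof -
    obtain P Q where "positive_laurent n2 P" "positive_laurent n2 Q" "\<psi> v = Fract P Q"
      using positive_rational_mapE[OF \<psi>(2) v] .
    then show ?thesis using \<psi>(3) v pullback_ratfun_value[OF \<psi>(1)] by metis
  qed
  moreover have "ratfun_value n1 const_ratfun \<psi> (\<phi> v) (char_ratfun v)" if v: "v \<in> lat n2" for v
  proof -
    obtain P Q where "positive_laurent n1 P" "positive_laurent n1 Q" "\<phi> v = Fract P Q"
      using positive_rational_mapE[OF \<psi>(1) v] .
    then show ?thesis using \<psi>(4) v pullback_ratfun_value[OF \<psi>(2)] by metis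
  qed
  ultimately show ?thesis using that \<psi> unfolding inverse_rational_maps_def by blast
qed

text \<open>By the composition law both sides at \<open>v\<close> are values at \<open>p\<close> of
  the character \<open>v\<close>, which is the pullback of \<open>\<psi> v\<close>.\<close>

lemma map_points_inverse:
  assumes inv: "inverse_rational_maps n1 n2 \<phi> \<psi>" and p: "p \<in> pos_points n1"
  shows "map_points n2 n1 \<psi> (map_points n1 n2 \<phi> p) = p"
proof -
  have \<phi>: "positive_rational_map n1 n2 \<phi>" and \<psi>: "positive_rational_map n2 n1 \<psi>"
    using inv by (simp_all add: inverse_rational_maps_def)
  interpret torus_point n1 "\<lambda>c. c" p by (rule torus_point_pos_point[OF p])
  let ?q = "map_points n1 n2 \<phi> p"
  have q: "?q \<in> pos_points n2" by (rule map_points_pos_points[OF \<phi> p])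
  have "map_points n2 n1 \<psi> ?q v = p v" if v: "v \<in> lat n1" for v
  proof (rule ratfun_value_unique)
    show "ratfun_value n1 (\<lambda>c. c) p (char_ratfun v) (map_points n2 n1 \<psi> ?q v)"
      using ratfun_value_pullback[OF positive_rational_map_rational[OF \<phi>] map_points_value(1)[OF \<phi> p]
          map_points_value(1)[OF \<psi> q v]] inv v by (simp add: inverse_rational_maps_def)
    show "ratfun_value n1 (\<lambda>c. c) p (char_ratfun v) (p v)"
      using ratfun_value_single[OF v, of 1] by simp
  qed
  then show ?thesis
    using map_points_pos_points[OF \<psi> q] p by (auto simp: pos_points_def intro: PiE_ext)
qed

text \<open>Evaluate \<open>pullback_laurent \<phi> W\<close> at the point \<open>\<psi>\<close>
  over the function field: computed through \<open>\<phi>\<close> the value is \<open>W\<close>,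
  computed through \<open>W'\<close> it is the pullback of \<open>W'\<close>.\<close>

lemma pullback_laurent_inverse:
  assumes inv: "inverse_rational_maps n1 n2 \<phi> \<psi>" and W: "W \<in> laurents n2" and W': "W' \<in> laurents n1"
    and eq: "pullback_laurent \<phi> W = Fract W' 1"
  shows "pullback_laurent \<psi> W' = Fract W 1"
proof -
  have \<psi>: "rational_map n2 n1 \<psi>"
    using inv by (simp add: inverse_rational_maps_def positive_rational_map_rational)
  interpret torus_point n1 const_ratfun \<psi> by (rule torus_point_rational_map[OF \<psi>])
  have "ratfun_value n1 const_ratfun \<psi> (pullback_laurent \<phi> W) (laurent_subst const_ratfun char_ratfun W)"
    by (rule ratfun_value_pullback_laurent[OF _ W]) (use inv in \<open>simp add: inverse_rational_maps_def\<close>)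
  then have "ratfun_value n1 const_ratfun \<psi> (Fract W' 1) (Fract W 1)"
    unfolding eq laurent_subst_char_ratfun .
  then show ?thesis
    unfolding pullback_laurent_eq_subst by (rule ratfun_value_unique[OF ratfun_value_Fract_one[OF W']])
qed

section \<open>Critical points\<close>

lemma pairing_superset:
  assumes "finite A" "Poly_Mapping.keys v \<subseteq> A"
  shows "pairing v u = (\<Sum>i\<in>A. Poly_Mapping.lookup v i * Poly_Mapping.lookup u i)"
  unfolding pairing_def
  by (rule sum.mono_neutral_left) (use assms in \<open>auto simp: in_keys_iff\<close>)

lemma pairing_add: "pairing (v + w) u = pairing v u + pairing w u"
proof -
  let ?A = "Poly_Mapping.keys v \<union> Poly_Mapping.keys w"
  have "z \<in> {v, w, v + w} \<Longrightarrow>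
      pairing z u = (\<Sum>i\<in>?A. Poly_Mapping.lookup z i * Poly_Mapping.lookup u i)" for z
    by (rule pairing_superset) (use Poly_Mapping.keys_add[of v w] in auto)
  then show ?thesis by (simp add: lookup_add distrib_right sum.distrib)
qed

lemma pairing_zero: "pairing 0 u = 0"
  by (simp add: pairing_def)

lemma pairing_single: "pairing v (Poly_Mapping.single i 1) = Poly_Mapping.lookup v i"
proof -
  have "pairing v (Poly_Mapping.single i 1) =
      (\<Sum>j\<in>Poly_Mapping.keys v. if j = i then Poly_Mapping.lookup v j else 0)"
    unfolding pairing_def by (rule sum.cong) (auto simp: lookup_single when_def)
  then show ?thesis by (simp add: in_keys_iff)
qed

lemma single_in_lat: "i < n \<Longrightarrow> Poly_Mapping.single i c \<in> lat n"
  by (simp add: lat_def)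

text \<open>Serves both logarithmic derivatives, with values in \<open>K\<close>, and real
  valuations; hence the general ring.\<close>

lemma additive_on_lat:
  fixes L :: "lattice \<Rightarrow> 'a::ring_1"
  assumes add: "\<And>v w. v \<in> lat n \<Longrightarrow> w \<in> lat n \<Longrightarrow> L (v + w) = L v + L w" and w: "w \<in> lat n"
  shows "L w = (\<Sum>i<n. of_int (Poly_Mapping.lookup w i) * L (Poly_Mapping.single i 1))"
proof -
  let ?s = "Poly_Mapping.single :: nat \<Rightarrow> int \<Rightarrow> lattice"
  have zero: "L 0 = 0"
    using add[OF zero_in_lat zero_in_lat] by simp
  have nat: "L (?s i (int k)) = of_nat k * L (?s i 1)" if "i < n" for i k
  proof (induction k)
    case (Suc k)
    have "?s i (int (Suc k)) = ?s i (int k) + ?s i 1" by (simp add: add.commute flip: single_add)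
    then show ?case
      using add[OF single_in_lat single_in_lat] that Suc by (simp add: algebra_simps)
  qed (simp add: zero)
  have int: "L (?s i k) = of_int k * L (?s i 1)" if i: "i < n" for i k
  proof (cases k)
    case (nonneg m)
    then show ?thesis using nat[OF i] by simp
  next
    case (neg m)
    have "L (?s i k) + L (?s i (int (Suc m))) = L (?s i k + ?s i (int (Suc m)))"
      using add[OF single_in_lat single_in_lat] i by simp
    also have "\<dots> = 0" by (simp add: neg zero flip: single_add)
    finally have "L (?s i k) = - L (?s i (int (Suc m)))" by (simp add: eq_neg_iff_add_eq_0)
    then show ?thesis unfolding nat[OF i] by (simp add: neg algebra_simps)
  qed
  have sum: "L (\<Sum>i\<in>A. f i) = (\<Sum>i\<in>A. L (f i)) \<and> (\<Sum>i\<in>A. f i) \<in> lat n"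
    if "finite A" "\<And>i. i \<in> A \<Longrightarrow> f i \<in> lat n" for A :: "nat set" and f
    using that by (induction A) (simp_all add: zero zero_in_lat add add_in_lat)
  have "w = (\<Sum>i<n. ?s i (Poly_Mapping.lookup w i))"
  proof (rule poly_mapping_eqI)
    fix j
    show "Poly_Mapping.lookup w j = Poly_Mapping.lookup (\<Sum>i<n. ?s i (Poly_Mapping.lookup w i)) j"
    proof -
      have "Poly_Mapping.lookup (\<Sum>i<n. ?s i (Poly_Mapping.lookup w i)) j
          = (\<Sum>i<n. if i = j then Poly_Mapping.lookup w i else 0)"
        unfolding lookup_sum by (rule sum.cong) (simp_all add: lookup_single when_def)
      also have "\<dots> = Poly_Mapping.lookup w j"
        using w by (auto simp: lat_def in_keys_iff)
      finally show ?thesis ..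
    qed
  qed
  then have "L w = (\<Sum>i<n. L (?s i (Poly_Mapping.lookup w i)))"
    using sum[of "{..<n}" "\<lambda>i. ?s i (Poly_Mapping.lookup w i)"] single_in_lat by (metis finite_lessThan lessThan_iff)
  also have "\<dots> = (\<Sum>i<n. of_int (Poly_Mapping.lookup w i) * L (?s i 1))"
    by (rule sum.cong) (auto intro: int)
  finally show ?thesis .
qed

text \<open>The curve \<open>s \<mapsto> exp(s u) q\<close> through a positive point \<open>q\<close>: substituting it into a Laurent
  polynomial makes the logarithmic derivative in direction \<open>u\<close> the coefficient of \<open>s\<close>.\<close>

definition log_curve :: "(lattice \<Rightarrow> puiseux) \<Rightarrow> lattice \<Rightarrow> lattice \<Rightarrow> puiseux fps" where
  "log_curve q u v = fps_const (q v) * fps_exp (of_int (pairing v u))"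

lemma torus_point_log_curve:
  assumes "q \<in> pos_points n" shows "torus_point n fps_const (log_curve q u)"
proof -
  interpret torus_point n "\<lambda>c. c" q by (rule torus_point_pos_point[OF assms])
  show ?thesis
  proof
    show "log_curve q u (v + w) = log_curve q u v * log_curve q u w"
      if "v \<in> lat n" "w \<in> lat n" for v w
    proof -
      have "log_curve q u (v + w) = fps_const (q v * q w) *
          (fps_exp (of_int (pairing v u)) * fps_exp (of_int (pairing w u)))"
        using that by (simp add: log_curve_def char_add pairing_add fps_exp_add_mult)
      then show ?thesis by (simp only: log_curve_def fps_const_mult[symmetric] ac_simps)
    qed
  qed (simp_all add: log_curve_def char_zero pairing_zero)
qed

lemma laurent_subst_log_curve_nth:
  shows "fps_nth (laurent_subst fps_const (log_curve q u) f) 0 = laurent_eval f q"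
    and "fps_nth (laurent_subst fps_const (log_curve q u) f) 1 =
      (\<Sum>v\<in>Poly_Mapping.keys f. Poly_Mapping.lookup f v * of_int (pairing v u) * q v)"
  by (simp_all add: laurent_subst_def laurent_eval_def log_curve_def fps_sum_nth ac_simps)

text \<open>The image under \<open>\<psi>\<close> of the curve \<open>log_curve q u\<close> need not
  be exponential. Its logarithmic derivative is still additive in the character, hence a combination
  of coordinate directions, in each of which the derivative of \<open>f\<close> vanishes.\<close>

lemma critical_point_transport:
  assumes \<psi>: "positive_rational_map n m \<psi>" and q: "q \<in> pos_points n"
    and f: "f \<in> laurents m" and g: "g \<in> laurents n" and fg: "pullback_laurent \<psi> f = Fract g 1"
    and crit: "positive_critical_point m f (map_points n m \<psi> q)"
  shows "positive_critical_point n g q"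
proof -
  let ?p = "map_points n m \<psi> q"
  have p: "?p \<in> pos_points m" by (rule map_points_pos_points[OF \<psi> q])
  have "(\<Sum>v\<in>Poly_Mapping.keys g. Poly_Mapping.lookup g v * of_int (pairing v u) * q v) = 0"
    if "u \<in> lat n" for u
  proof -
    let ?c = "log_curve q u"
    interpret torus_point n fps_const ?c by (rule torus_point_log_curve[OF q])
    have "\<exists>c. ratfun_value n fps_const ?c (\<psi> w) c \<and> fps_nth c 0 = ?p w" if w: "w \<in> lat m" for w
    proof -
      obtain P Q where PQ: "positive_laurent n P" "positive_laurent n Q" "\<psi> w = Fract P Q"
        using positive_rational_mapE[OF \<psi> w] .
      let ?h = "laurent_subst fps_const ?c"
      \<comment> \<open>The constant coefficient is the positive value of \<open>Q\<close> at
        \<open>q\<close>, so \<open>Q\<close> becomes a unit of \<open>K[[s]]\<close> and the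
        quotient is again a power series.\<close>
      have Q0: "fps_nth (?h Q) 0 \<noteq> 0"
        using Kpos_nonzero[OF laurent_eval_Kpos(1)[OF PQ(2) q]] by (simp add: laurent_subst_log_curve_nth)
      then have "?h Q \<noteq> 0" by auto
      have "?h P * inverse (?h Q) * ?h Q = ?h P"
        using inverse_mult_eq_1[OF Q0] by (simp add: mult.assoc)
      then have "ratfun_value n fps_const ?c (\<psi> w) (?h P * inverse (?h Q))"
        unfolding PQ(3) using PQ \<open>?h Q \<noteq> 0\<close> by (intro ratfun_valueI) (simp_all add: positive_laurent_laurents)
      moreover have "fps_nth (?h P * inverse (?h Q)) 0 = ?p w"
        using w ratfun_eval_Fract(1)[OF q PQ(1,2)]
        by (simp add: map_points_def PQ(3) laurent_subst_log_curve_nth divide_inverse)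
      ultimately show ?thesis by blast
    qed
    then obtain c where c: "\<And>w. w \<in> lat m \<Longrightarrow> ratfun_value n fps_const ?c (\<psi> w) (c w)"
        and c0: "\<And>w. w \<in> lat m \<Longrightarrow> fps_nth (c w) 0 = ?p w"
      by metis
    interpret c: torus_point m fps_const c
      by (rule torus_point_image[OF positive_rational_map_rational[OF \<psi>] c])
    \<comment> \<open>Logarithmic derivative of the image arc at \<open>s = 0\<close>; the product
      rule makes it additive.\<close>
    define L where "L w = fps_nth (c w) 1 / ?p w" for w
    have p_nz: "?p w \<noteq> 0" if "w \<in> lat m" for w
      using Kpos_nonzero[OF pos_points_Kpos[OF p that]] .
    have "L (v + w) = L v + L w" if "v \<in> lat m" "w \<in> lat m" for v w
    proof -
      have "?p (v + w) = ?p v * ?p w"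
        using p that by (simp add: pos_points_def)
      moreover have "fps_nth (c (v + w)) 1 = ?p v * fps_nth (c w) 1 + fps_nth (c v) 1 * ?p w"
        using that by (simp add: c.char_add fps_mult_nth_1 c0 add_in_lat)
      ultimately show ?thesis
        using p_nz that by (simp add: L_def field_simps)
    qed
    then have L: "L w = (\<Sum>i<m. of_int (Poly_Mapping.lookup w i) * L (Poly_Mapping.single i 1))"
      if "w \<in> lat m" for w
      using additive_on_lat that by blast
    have "ratfun_value n fps_const ?c (pullback_laurent \<psi> f) (laurent_subst fps_const c f)"
      by (rule ratfun_value_pullback_laurent[OF _ f]) (rule c)
    then have "laurent_subst fps_const c f = laurent_subst fps_const ?c g"
      unfolding fg by (rule ratfun_value_unique[OF _ ratfun_value_Fract_one[OF g]])
    \<comment> \<open>The derivative of \<open>g\<close> is the coefficient of \<open>s\<close>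
      along the curve, and the whole series agrees with that of \<open>f\<close> along the image
      arc.\<close>
    then have "(\<Sum>v\<in>Poly_Mapping.keys g. Poly_Mapping.lookup g v * of_int (pairing v u) * q v)
        = fps_nth (laurent_subst fps_const c f) 1"
      by (simp only: laurent_subst_log_curve_nth)
    also have "\<dots> = (\<Sum>w\<in>Poly_Mapping.keys f. Poly_Mapping.lookup f w * fps_nth (c w) 1)"
      by (simp add: laurent_subst_def fps_sum_nth)
    also have "\<dots> = (\<Sum>w\<in>Poly_Mapping.keys f. \<Sum>i<m. L (Poly_Mapping.single i 1) *
        (Poly_Mapping.lookup f w * of_int (pairing w (Poly_Mapping.single i 1)) * ?p w))"
    proof (rule sum.cong[OF refl])
      fix w assume "w \<in> Poly_Mapping.keys f"
      then have w: "w \<in> lat m" using f by (auto simp: laurents_def)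
      have "Poly_Mapping.lookup f w * fps_nth (c w) 1 = Poly_Mapping.lookup f w * ?p w * L w"
        using p_nz[OF w] by (simp add: L_def)
      also have "\<dots> = (\<Sum>i<m. L (Poly_Mapping.single i 1) *
          (Poly_Mapping.lookup f w * of_int (pairing w (Poly_Mapping.single i 1)) * ?p w))"
        unfolding L[OF w] sum_distrib_left by (intro sum.cong refl) (simp add: pairing_single)
      finally show "Poly_Mapping.lookup f w * fps_nth (c w) 1 = \<dots>" .
    qed
    also have "\<dots> = (\<Sum>i<m. L (Poly_Mapping.single i 1) * (\<Sum>w\<in>Poly_Mapping.keys f.
        Poly_Mapping.lookup f w * of_int (pairing w (Poly_Mapping.single i 1)) * ?p w))"
      unfolding sum_distrib_left by (rule sum.swap)
    also have "\<dots> = 0"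
      using crit by (intro sum.neutral) (auto simp: positive_critical_point_def single_in_lat)
    finally show ?thesis .
  qed
  then show ?thesis using q by (simp add: positive_critical_point_def)
qed

text \<open>Transport is applied to the inverse map at the image point, which goes back to
  \<open>p\<close>.\<close>

lemma critical_point_image:
  assumes inv: "inverse_rational_maps n1 n2 \<phi> \<psi>" and W: "W \<in> laurents n2" and W': "W' \<in> laurents n1"
    and eq: "pullback_laurent \<phi> W = Fract W' 1" and p: "positive_critical_point n1 W' p"
  shows "positive_critical_point n2 W (map_points n1 n2 \<phi> p)"
proof (rule critical_point_transport[OF _ _ W' W pullback_laurent_inverse[OF inv W W' eq]])
  have p_pos: "p \<in> pos_points n1" using p by (simp add: positive_critical_point_def)
  show "positive_rational_map n2 n1 \<psi>" using inv by (simp add: inverse_rational_maps_def)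
  show "map_points n1 n2 \<phi> p \<in> pos_points n2"
    by (rule map_points_pos_points[OF _ p_pos]) (use inv in \<open>simp add: inverse_rational_maps_def\<close>)
  show "positive_critical_point n1 W' (map_points n2 n1 \<psi> (map_points n1 n2 \<phi> p))"
    unfolding map_points_inverse[OF inv p_pos] by (rule p)
qed

text \<open>By symmetry \<open>\<psi>\<close> sends any critical point of \<open>W\<close> to one of
  \<open>W'\<close>, hence to \<open>p\<close>; applying \<open>\<phi>\<close> identifies
  it.\<close>

lemma unique_critical_point_image:
  assumes inv: "inverse_rational_maps n1 n2 \<phi> \<psi>" and W: "W \<in> laurents n2" and W': "W' \<in> laurents n1"
    and eq: "pullback_laurent \<phi> W = Fract W' 1" and p: "unique_positive_critical_point n1 W' p"
  shows "unique_positive_critical_point n2 W (map_points n1 n2 \<phi> p)"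
  unfolding unique_positive_critical_point_def
proof (intro conjI allI impI)
  have "positive_critical_point n1 W' p"
    using p unfolding unique_positive_critical_point_def by blast
  then show "positive_critical_point n2 W (map_points n1 n2 \<phi> p)"
    by (rule critical_point_image[OF inv W W' eq])
  note inv' = inverse_rational_maps_sym[OF inv]
  fix q assume q: "positive_critical_point n2 W q"
  then have "positive_critical_point n1 W' (map_points n2 n1 \<psi> q)"
    by (rule critical_point_image[OF inv' W' W pullback_laurent_inverse[OF inv W W' eq]])
  then have qp: "map_points n2 n1 \<psi> q = p"
    using p unfolding unique_positive_critical_point_def by blast
  have "map_points n1 n2 \<phi> (map_points n2 n1 \<psi> q) = q"
    by (rule map_points_inverse[OF inv']) (use q in \<open>simp add: positive_critical_point_def\<close>)
  then show "q = map_points n1 n2 \<phi> p" unfolding qp ..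
qed

section \<open>Tropicalisation of positive maps\<close>

text \<open>The tropical polynomials of numerator and denominator see a point only through its
  valuations.\<close>

lemma map_points_trop_rel:
  assumes \<phi>: "positive_rational_map n m \<phi>" and xy: "(x, y) \<in> trop_rel n"
  shows "(map_points n m \<phi> x, map_points n m \<phi> y) \<in> trop_rel m"
proof -
  have x: "x \<in> pos_points n" and y: "y \<in> pos_points n"
    and eq: "\<And>v. v \<in> lat n \<Longrightarrow> pval (x v) = pval (y v)"
    using xy unfolding trop_rel_def by blast+
  have "pval (map_points n m \<phi> x v) = pval (map_points n m \<phi> y v)" if v: "v \<in> lat m" for v
  proof -
    obtain P Q where PQ: "positive_laurent n P" "positive_laurent n Q" "\<phi> v = Fract P Q"
      using positive_rational_mapE[OF \<phi> v] .
    have "pval (laurent_eval R x) = pval (laurent_eval R y)" if R: "positive_laurent n R" for R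
    proof -
      have "Poly_Mapping.keys R \<subseteq> lat n" using R by (simp add: positive_laurent_def laurents_def)
      then show ?thesis
        unfolding laurent_eval_Kpos(2)[OF R x] laurent_eval_Kpos(2)[OF R y]
        by (intro arg_cong[where f = Min] image_cong) (auto simp: eq)
    qed
    moreover have "pval (map_points n m \<phi> z v) = pval (laurent_eval P z) - pval (laurent_eval Q z)"
      if "z \<in> pos_points n" for z
      using v ratfun_eval_Fract(1)[OF that PQ(1,2)]
        Kpos_divide(2)[OF laurent_eval_Kpos(1)[OF PQ(1) that] laurent_eval_Kpos(1)[OF PQ(2) that]]
      by (simp add: map_points_def PQ(3))
    ultimately show ?thesis using PQ x y by metis
  qed
  then show ?thesis
    unfolding trop_rel_def using map_points_pos_points[OF \<phi>] x y by blast
qed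

text \<open>Every set in the union defining \<open>Trop_map\<close> is the same class, as equivalent
  points have equivalent images.\<close>

lemma Trop_map_trop_class:
  assumes \<phi>: "positive_rational_map n m \<phi>" and x: "x \<in> pos_points n"
  shows "Trop_map n m \<phi> (trop_class n x) = trop_class m (map_points n m \<phi> x)"
proof -
  have "trop_class m (map_points n m \<phi> y) = trop_class m (map_points n m \<phi> x)"
    if "y \<in> trop_class n x" for y
  proof -
    have "(map_points n m \<phi> x, map_points n m \<phi> y) \<in> trop_rel m"
      using map_points_trop_rel[OF \<phi>, of x y] that by (simp add: trop_class_def)
    then show ?thesis unfolding trop_class_def trop_rel_def by fastforce
  qed
  moreover have "x \<in> trop_class n x" using x by (simp add: trop_class_def trop_rel_def)
  ultimately show ?thesis unfolding Trop_map_def by blast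
qed

section \<open>Complete Laurent polynomials\<close>

lemma farkas:
  fixes a :: "'i \<Rightarrow> 'v::real_vector \<Rightarrow> real"
  assumes "finite I" "\<And>i. i \<in> I \<Longrightarrow> linear (a i)" "linear b"
    and "\<And>x. (\<And>i. i \<in> I \<Longrightarrow> 0 \<le> a i x) \<Longrightarrow> 0 \<le> b x"
  shows "\<exists>c. (\<forall>i\<in>I. 0 \<le> c i) \<and> (\<forall>x. b x = (\<Sum>i\<in>I. c i * a i x))"
  using assms
proof (induction I arbitrary: a b rule: finite_induct)
  case empty
  have "b x = 0" for x
    using empty.prems(3)[of x] empty.prems(3)[of "- x"] linear_neg[OF empty.prems(2), of x] by simp
  then show ?case by simp
next
  case (insert j I)
  show ?case
  proof (cases "\<forall>x. (\<forall>i\<in>I. 0 \<le> a i x) \<longrightarrow> 0 \<le> b x")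
    case True
    then obtain c where c: "\<forall>i\<in>I. 0 \<le> c i" "\<And>x. b x = (\<Sum>i\<in>I. c i * a i x)"
      using insert.IH[of a b] insert.prems by blast
    have "b x = (\<Sum>i\<in>insert j I. (c(j := 0)) i * a i x)" for x
      unfolding c(2) using insert.hyps by (auto intro!: sum.cong)
    then show ?thesis using c(1) by (intro exI[of _ "c(j := 0)"]) auto
  next
    case False
    \<comment> \<open>This \<open>z\<close> shows that \<open>a j\<close> cannot be dropped, so it
      must violate the inequality for \<open>a j\<close>; rescaled, it spans a complement of the
      kernel.\<close>
    then obtain z where z: "\<And>i. i \<in> I \<Longrightarrow> 0 \<le> a i z" "b z < 0" by (auto simp: not_le)
    then have "a j z < 0" using insert.prems(3)[of z] by (metis insertE not_le)
    define r where "r = - inverse (a j z)"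
    have r: "0 < r" "r * a j z = -1" using \<open>a j z < 0\<close> by (simp_all add: r_def)
    define y where "y = r *\<^sub>R z"
    note lin = linear_add linear_scale
    have y: "a j y = -1" "b y < 0" "\<And>i. i \<in> I \<Longrightarrow> 0 \<le> a i y"
      using z r insert.prems(1,2)
      by (simp_all add: y_def lin mult_less_0_iff zero_le_mult_iff less_imp_le)
    \<comment> \<open>precomposition with the projection onto the kernel of \<open>a j\<close> along \<open>y\<close>\<close>
    define T where "T f x = f (x + a j x *\<^sub>R y)" for f :: "'v \<Rightarrow> real" and x
    have T: "T f x = f x + a j x * f y" if "linear f" for f x
      using that by (simp add: T_def lin)
    have linT: "linear (T f)" if "linear f" for f
      unfolding T[OF that] using that insert.prems(1)[of j]
      by (intro linearI) (simp_all add: T lin algebra_simps)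
    have "0 \<le> T b x" if x: "\<And>i. i \<in> I \<Longrightarrow> 0 \<le> T (a i) x" for x
      unfolding T_def
    proof (rule insert.prems(3))
      fix i assume "i \<in> insert j I"
      moreover have "a j (x + a j x *\<^sub>R y) = 0"
        using y(1) insert.prems(1)[of j] by (simp add: lin)
      ultimately show "0 \<le> a i (x + a j x *\<^sub>R y)" using x by (auto simp: T_def)
    qed
    then obtain c where c: "\<forall>i\<in>I. 0 \<le> c i" "\<And>x. T b x = (\<Sum>i\<in>I. c i * T (a i) x)"
      using insert.IH[of "\<lambda>i. T (a i)" "T b"] linT insert.prems by blast
    \<comment> \<open>Undoing the projection leaves this multiple of \<open>a j\<close>. It is
      nonnegative because \<open>b y < 0\<close> while the \<open>a i y\<close> are
      nonnegative.\<close>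
    define d where "d = (\<Sum>i\<in>I. c i * a i y) - b y"
    have "b x = (\<Sum>i\<in>insert j I. (c(j := d)) i * a i x)" for x
    proof -
      have "b x + a j x * b y = (\<Sum>i\<in>I. c i * (a i x + a j x * a i y))"
        using c(2)[of x] insert.prems(1,2) by (simp add: T)
      also have "\<dots> = (\<Sum>i\<in>I. c i * a i x) + a j x * (\<Sum>i\<in>I. c i * a i y)"
        by (simp add: algebra_simps sum.distrib sum_distrib_left)
      finally have "b x = d * a j x + (\<Sum>i\<in>I. c i * a i x)"
        by (simp add: d_def algebra_simps)
      also have "(\<Sum>i\<in>I. c i * a i x) = (\<Sum>i\<in>I. (c(j := d)) i * a i x)"
        using insert.hyps by (auto intro!: sum.cong)
      finally show ?thesis using insert.hyps by simp
    qed
    moreover have "0 \<le> d"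
      unfolding d_def using c(1) y by (simp add: sum_nonneg less_imp_le order_trans[of _ 0])
    ultimately show ?thesis using c(1) by (intro exI[of _ "c(j := d)"]) auto
  qed
qed

section \<open>Interior points of the Newton polytope\<close>

lemma lookup_scaleR_poly_mapping:
  "Poly_Mapping.lookup (r *\<^sub>R x) i = r *\<^sub>R Poly_Mapping.lookup x i"
proof -
  have "finite {i. r *\<^sub>R Poly_Mapping.lookup x i \<noteq> 0}"
    by (rule finite_subset[OF _ finite_keys[of x]]) (auto simp: in_keys_iff)
  then show ?thesis by (simp add: scaleR_poly_mapping_def)
qed

lemma lookup_map_of_int: "Poly_Mapping.lookup (Poly_Mapping.map real_of_int v) i = of_int (Poly_Mapping.lookup v i)"
  by (simp add: Poly_Mapping.map.rep_eq when_def)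

lemma map_of_int_real_lat: "v \<in> lat n \<Longrightarrow> Poly_Mapping.map real_of_int v \<in> real_lat n"
  by (auto simp: real_lat_def lat_def in_keys_iff lookup_map_of_int)

lemma norm_real_lat:
  assumes "y \<in> real_lat n" shows "norm y = (\<Sum>i<n. \<bar>Poly_Mapping.lookup y i\<bar>)"
  unfolding norm_poly_mapping_def dist_poly_mapping_def
  by (rule sum.mono_neutral_cong_left) (use assms in \<open>auto simp: real_lat_def in_keys_iff\<close>)

text \<open>The missing weight is given to the origin.\<close>

lemma convex_contains_subconvex_sum:
  fixes f :: "'i \<Rightarrow> 'v::real_vector"
  assumes S: "convex S" "0 \<in> S" and "finite I" "\<And>i. i \<in> I \<Longrightarrow> 0 \<le> c i" "sum c I \<le> 1"
    "\<And>i. i \<in> I \<Longrightarrow> f i \<in> S"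
  shows "(\<Sum>i\<in>I. c i *\<^sub>R f i) \<in> S"
proof (cases "sum c I = 0")
  case True
  then have "\<And>i. i \<in> I \<Longrightarrow> c i = 0" using assms by (simp add: sum_nonneg_eq_0_iff)
  then show ?thesis using S by simp
next
  case False
  have pos: "0 \<le> sum c I" using assms by (simp add: sum_nonneg)
  define z where "z = (\<Sum>i\<in>I. (c i / sum c I) *\<^sub>R f i)"
  have "z \<in> S"
    unfolding z_def using assms False pos
    by (intro convex_sum) (auto simp: sum_divide_distrib[symmetric])
  then have "sum c I *\<^sub>R z + (1 - sum c I) *\<^sub>R 0 \<in> S"
    using assms pos by (intro convexD[OF S(1)]) auto
  moreover have "sum c I *\<^sub>R z = (\<Sum>i\<in>I. c i *\<^sub>R f i)"
    unfolding z_def scaleR_sum_right using False by simp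
  ultimately show ?thesis by simp
qed

text \<open>Under \<open>trivial\<close>, the Farkas lemma makes every signed unit vector a
  nonnegative combination of exponents. Small vectors are then such combinations of total weight at
  most 1, and lie in the polytope once the origin does.\<close>

lemma complete_laurentI:
  assumes W: "W \<in> laurents n" "W \<noteq> 0"
    and trivial: "\<And>x j. (\<And>v. v \<in> Poly_Mapping.keys W \<Longrightarrow>
      0 \<le> (\<Sum>i<n. of_int (Poly_Mapping.lookup v i) * x i)) \<Longrightarrow> j < n \<Longrightarrow> x j = (0::real)"
  shows "complete_laurent n W"
proof -
  let ?V = "Poly_Mapping.keys W" and ?e = "Poly_Mapping.map real_of_int"
  have lat: "v \<in> lat n" if "v \<in> ?V" for v using W that by (auto simp: laurents_def)
  have unit: "\<exists>c. (\<forall>v\<in>?V. 0 \<le> c v) \<and>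
      (\<forall>k<n. (\<Sum>v\<in>?V. c v * of_int (Poly_Mapping.lookup v k)) = (if k = j then s else 0))"
    if j: "j < n" for j and s :: real
  proof -
    define a where "a v x = (\<Sum>i<n. of_int (Poly_Mapping.lookup v i) * Poly_Mapping.lookup x i)"
      for v :: lattice and x :: "nat \<Rightarrow>\<^sub>0 real"
    have "\<exists>c. (\<forall>v\<in>?V. 0 \<le> c v) \<and> (\<forall>x. s * Poly_Mapping.lookup x j = (\<Sum>v\<in>?V. c v * a v x))"
    proof (rule farkas)
      show "linear (a v)" for v
        by (rule linearI) (simp_all add: a_def lookup_add lookup_scaleR_poly_mapping
            distrib_left sum.distrib sum_distrib_left ac_simps)
      show "linear (\<lambda>x. s * Poly_Mapping.lookup x j)"
        by (rule linearI) (simp_all add: lookup_add lookup_scaleR_poly_mapping algebra_simps)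
      \<comment> \<open>Feasible \<open>x\<close> have \<open>x j = 0\<close>, so the sign of
        \<open>s\<close> does not matter.\<close>
      show "0 \<le> s * Poly_Mapping.lookup x j" if "\<And>v. v \<in> ?V \<Longrightarrow> 0 \<le> a v x" for x
        using trivial[OF _ j, of "Poly_Mapping.lookup x"] that by (simp add: a_def)
    qed simp
    then obtain c where c: "\<forall>v\<in>?V. 0 \<le> c v"
        "\<And>x. s * Poly_Mapping.lookup x j = (\<Sum>v\<in>?V. c v * a v x)" by blast
    have "a v (Poly_Mapping.single k 1) = (\<Sum>i<n. if i = k then of_int (Poly_Mapping.lookup v i) else 0)" for v k
      unfolding a_def by (rule sum.cong) (auto simp: lookup_single when_def)
    then have "a v (Poly_Mapping.single k 1) = of_int (Poly_Mapping.lookup v k)" if "k < n" for v k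
      using that by simp
    then have "(\<Sum>v\<in>?V. c v * of_int (Poly_Mapping.lookup v k)) = (if k = j then s else 0)"
      if "k < n" for k
      using c(2)[of "Poly_Mapping.single k 1"] that by (auto simp: lookup_single when_def split: if_splits)
    then show ?thesis using c(1) by blast
  qed
  then have "\<forall>j s. \<exists>c. j < n \<longrightarrow> (\<forall>v\<in>?V. 0 \<le> c v) \<and>
      (\<forall>k<n. (\<Sum>v\<in>?V. c v * of_int (Poly_Mapping.lookup v k)) = (if k = j then s else (0::real)))"
    by blast
  then obtain c where c: "\<And>j s v. j < n \<Longrightarrow> v \<in> ?V \<Longrightarrow> 0 \<le> c j s v"
      "\<And>j s k. j < n \<Longrightarrow> k < n \<Longrightarrow>
        (\<Sum>v\<in>?V. c j s v * of_int (Poly_Mapping.lookup v k)) = (if k = j then s else (0::real))"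
    by metis
  \<comment> \<open>The weights for all signed unit vectors together, hence a bound on the total
    weight for each of them.\<close>
  define C where "C = (\<Sum>j<n. \<Sum>v\<in>?V. c j 1 v + c j (-1) v)"
  have C: "0 \<le> C" unfolding C_def using c(1) by (intro sum_nonneg) auto
  have cone: "\<exists>d. (\<forall>v\<in>?V. 0 \<le> d v) \<and> y = (\<Sum>v\<in>?V. d v *\<^sub>R ?e v) \<and> sum d ?V \<le> C * norm y"
    if y: "y \<in> real_lat n" for y
  proof -
    let ?y = "Poly_Mapping.lookup y"
    \<comment> \<open>Splits \<open>y\<close> into multiples of signed unit vectors. A coordinate 0
      has sign 0, but then the factor in front vanishes.\<close>
    define d where "d v = (\<Sum>j<n. \<bar>?y j\<bar> * c j (sgn (?y j)) v)" for v
    have "y = (\<Sum>v\<in>?V. d v *\<^sub>R ?e v)"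
    proof (rule poly_mapping_eqI)
      fix k
      show "?y k = Poly_Mapping.lookup (\<Sum>v\<in>?V. d v *\<^sub>R ?e v) k"
      proof (cases "k < n")
        case True
        have "Poly_Mapping.lookup (\<Sum>v\<in>?V. d v *\<^sub>R ?e v) k
            = (\<Sum>v\<in>?V. \<Sum>j<n. \<bar>?y j\<bar> * (c j (sgn (?y j)) v * of_int (Poly_Mapping.lookup v k)))"
          by (simp add: lookup_sum lookup_scaleR_poly_mapping lookup_map_of_int d_def
              sum_distrib_right mult.assoc)
        also have "\<dots> = (\<Sum>j<n. \<bar>?y j\<bar> * (\<Sum>v\<in>?V. c j (sgn (?y j)) v * of_int (Poly_Mapping.lookup v k)))"
          unfolding sum_distrib_left by (rule sum.swap)
        also have "\<dots> = (\<Sum>j<n. if k = j then ?y j else 0)"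
          using c(2) True by (intro sum.cong refl) (auto simp: abs_mult_sgn)
        also have "\<dots> = ?y k" using True by simp
        finally show ?thesis by simp
      next
        case False
        have "Poly_Mapping.lookup v k = 0" if "v \<in> ?V" for v
          using lat[OF that] False by (auto simp: lat_def in_keys_iff)
        moreover have "?y k = 0" using y False by (auto simp: real_lat_def in_keys_iff)
        ultimately show ?thesis
          by (simp add: lookup_sum lookup_scaleR_poly_mapping lookup_map_of_int)
      qed
    qed
    moreover have d0: "0 \<le> d v" if "v \<in> ?V" for v
      unfolding d_def using c(1) that by (intro sum_nonneg mult_nonneg_nonneg) auto
    moreover have "sum d ?V \<le> C * norm y"
    proof -
      have "(\<Sum>v\<in>?V. \<bar>?y j\<bar> * c j (sgn (?y j)) v) \<le> \<bar>?y j\<bar> * C" if j: "j < n" for j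
      proof (cases "?y j = 0")
        case False
        then have "sgn (?y j) \<in> {1, -1}" by (auto simp: sgn_if)
        then have "(\<Sum>v\<in>?V. c j (sgn (?y j)) v) \<le> (\<Sum>v\<in>?V. c j 1 v + c j (-1) v)"
          using c(1) j by (intro sum_mono) auto
        also have "\<dots> \<le> C"
          unfolding C_def using j c(1)
          by (intro member_le_sum[where f = "\<lambda>j. \<Sum>v\<in>?V. c j 1 v + c j (-1) v"]) (auto intro!: sum_nonneg)
        finally show ?thesis
          by (simp add: mult_left_mono flip: sum_distrib_left)
      qed simp
      then have "(\<Sum>j<n. \<Sum>v\<in>?V. \<bar>?y j\<bar> * c j (sgn (?y j)) v) \<le> (\<Sum>j<n. \<bar>?y j\<bar> * C)"
        by (intro sum_mono) auto
      then show ?thesis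
        unfolding d_def norm_real_lat[OF y] sum_distrib_right[symmetric]
        by (subst sum.swap) (simp add: mult.commute)
    qed
    ultimately show ?thesis by blast
  qed
  let ?H = "newton_polytope W"
  have H: "convex ?H" "?e v \<in> ?H" if "v \<in> ?V" for v
    using that by (auto simp: newton_polytope_def intro: hull_inc)
  obtain v0 where v0: "v0 \<in> ?V" using W by (metis keys_eq_empty equals0I)
  \<comment> \<open>Adding \<open>v0\<close> to a representation of its negative gives a relation
    among the exponents of total weight at least 1, which is normalised to a convex
    combination.\<close>
  have zero: "0 \<in> ?H"
  proof -
    have "- ?e v0 \<in> real_lat n"
      using map_of_int_real_lat[OF lat[OF v0]] by (simp add: real_lat_def)
    then obtain d where d: "\<And>v. v \<in> ?V \<Longrightarrow> 0 \<le> d v" "- ?e v0 = (\<Sum>v\<in>?V. d v *\<^sub>R ?e v)"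
      using cone by blast
    define d' where "d' v = d v + (if v = v0 then 1 else 0)" for v
    have sum: "sum d' ?V = sum d ?V + 1"
      using v0 by (simp add: d'_def sum.distrib)
    then have pos: "0 < sum d' ?V" using d(1) by (simp add: sum_nonneg add_nonneg_pos)
    have "(\<Sum>v\<in>?V. d' v *\<^sub>R ?e v) = (\<Sum>v\<in>?V. d v *\<^sub>R ?e v) + (\<Sum>v\<in>?V. if v = v0 then ?e v0 else 0)"
      unfolding d'_def scaleR_add_left sum.distrib by (intro arg_cong2[where f = "(+)"] refl sum.cong) auto
    also have "\<dots> = 0" using v0 by (simp flip: d(2))
    finally have "0 = inverse (sum d' ?V) *\<^sub>R (\<Sum>v\<in>?V. d' v *\<^sub>R ?e v)" by simp
    also have "\<dots> = (\<Sum>v\<in>?V. (d' v / sum d' ?V) *\<^sub>R ?e v)"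
      by (simp add: scaleR_sum_right divide_inverse mult.commute)
    also have "\<dots> \<in> ?H"
      using d(1) pos H v0
      by (intro convex_sum) (auto simp: d'_def[of v0] sum_divide_distrib[symmetric] d'_def)
    finally show ?thesis .
  qed
  \<comment> \<open>This radius keeps total weights at most 1; the added 1 covers
    \<open>C = 0\<close>, which occurs for \<open>n = 0\<close>.\<close>
  define T where "T = real_lat n \<inter> ball 0 (1 / (C + 1))"
  have "T \<subseteq> ?H"
  proof
    fix y assume y: "y \<in> T"
    then obtain d where d: "\<And>v. v \<in> ?V \<Longrightarrow> 0 \<le> d v" "y = (\<Sum>v\<in>?V. d v *\<^sub>R ?e v)"
        "sum d ?V \<le> C * norm y"
      using cone[of y] by (auto simp: T_def)
    have "C * norm y \<le> C * (1 / (C + 1))" using y C by (intro mult_left_mono) (auto simp: T_def)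
    also have "\<dots> \<le> 1" using C by simp
    finally have "sum d ?V \<le> 1" using d(3) by simp
    then show "y \<in> ?H"
      unfolding d(2) using d(1) H v0 zero by (intro convex_contains_subconvex_sum) auto
  qed
  moreover have "openin (top_of_set (real_lat n)) T" "0 \<in> T"
    using C by (auto simp: T_def openin_open real_lat_def)
  ultimately show ?thesis by (auto simp: complete_laurent_def interior_of_def)
qed

text \<open>A lower bound for a linear functional on the exponents extends to the polytope, which
  contains \<open>e\<close> times every signed unit vector. As \<open>e\<close> depends only on
  \<open>W\<close>, the bound is uniform over families of \<open>Y\<close>.\<close>

lemma complete_laurent_bound:
  assumes "complete_laurent n W"
  obtains e :: real where "e > 0"
    "\<And>Y c j. (\<And>v. v \<in> Poly_Mapping.keys W \<Longrightarrow> - c \<le> (\<Sum>i<n. of_int (Poly_Mapping.lookup v i) * Y i)) \<Longrightarrow>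
      j < n \<Longrightarrow> e * \<bar>Y j\<bar> \<le> c"
proof -
  obtain T where T: "openin (top_of_set (real_lat n)) T" "0 \<in> T" "T \<subseteq> newton_polytope W"
    using assms by (auto simp: complete_laurent_def interior_of_def)
  then obtain U where U: "open U" "T = real_lat n \<inter> U" by (auto simp: openin_open)
  then obtain \<delta> where \<delta>: "\<delta> > 0" "ball 0 \<delta> \<subseteq> U" using T(2) by (auto simp: open_contains_ball)
  \<comment> \<open>Half the radius, so that vectors of norm \<open>e\<close> lie in the open
    ball.\<close>
  define e where "e = \<delta> / 2"
  have "e > 0" using \<delta> by (simp add: e_def)
  moreover have "e * \<bar>Y j\<bar> \<le> c"
    if Y: "\<And>v. v \<in> Poly_Mapping.keys W \<Longrightarrow> - c \<le> (\<Sum>i<n. of_int (Poly_Mapping.lookup v i) * Y i)"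
      and j: "j < n" for Y c j
  proof -
    let ?F = "\<lambda>z. \<Sum>i<n. Poly_Mapping.lookup z i * Y i"
    have F: "?F (a + b) = ?F a + ?F b" "?F (r *\<^sub>R a) = r * ?F a" for a b r
      by (simp_all add: lookup_add lookup_scaleR_poly_mapping distrib_right sum.distrib sum_distrib_left mult.assoc)
    have "convex {z. - c \<le> ?F z}"
    proof (rule convexI)
      fix x y and u v :: real
      assume *: "x \<in> {z. - c \<le> ?F z}" "y \<in> {z. - c \<le> ?F z}" "0 \<le> u" "0 \<le> v" "u + v = 1"
      have "- c = (u + v) * (- c)" using *(5) by simp
      also have "\<dots> = u * (- c) + v * (- c)" by (rule distrib_right)
      also have "\<dots> \<le> u * ?F x + v * ?F y" using * by (intro add_mono mult_left_mono) auto
      finally show "u *\<^sub>R x + v *\<^sub>R y \<in> {z. - c \<le> ?F z}" by (simp add: F)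
    qed
    then have hull: "newton_polytope W \<subseteq> {z. - c \<le> ?F z}"
      unfolding newton_polytope_def using Y by (intro hull_minimal) (auto simp: lookup_map_of_int)
    have "- c \<le> s * Y j" if s: "\<bar>s\<bar> = e" for s
    proof -
      let ?z = "Poly_Mapping.single j s"
      have z: "?z \<in> real_lat n" using j by (simp add: real_lat_def)
      have "norm ?z = e"
        using s by (auto simp: norm_poly_mapping_def dist_poly_mapping_def)
      then have "?z \<in> newton_polytope W" using z \<delta> U T \<open>e > 0\<close> by (auto simp: e_def subset_iff)
      then have "- c \<le> ?F ?z" using hull by blast
      also have "?F ?z = (\<Sum>i<n. if i = j then s * Y i else 0)"
        by (rule sum.cong) (auto simp: lookup_single when_def)
      also have "\<dots> = s * Y j" using j by simp
      finally show ?thesis .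
    qed
    from this[of e] this[of "- e"] show ?thesis using \<open>e > 0\<close> by (simp add: abs_if)
  qed
  ultimately show ?thesis using that by blast
qed

section \<open>Valuations along one-parameter families of points\<close>

lemma one_parameter_pos_points:
  "(\<lambda>v\<in>lat n. puiseux_monom (\<Sum>i<n. of_int (Poly_Mapping.lookup v i) * x i)) \<in> pos_points n"
  by (auto simp: pos_points_def Kpos_puiseux_monom add_in_lat lookup_add distrib_right sum.distrib
      simp flip: puiseux_monom_add)

lemma pval_laurent_eval_le:
  assumes "positive_laurent n P" "p \<in> pos_points n" "v \<in> Poly_Mapping.keys P"
  shows "pval (laurent_eval P p) \<le> pval (Poly_Mapping.lookup P v) + pval (p v)"
  unfolding laurent_eval_Kpos(2)[OF assms(1,2)] using assms(3) by (intro Min_le) auto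

lemma pval_laurent_eval_attained:
  assumes "positive_laurent n P" "p \<in> pos_points n"
  obtains v where "v \<in> Poly_Mapping.keys P"
    "pval (laurent_eval P p) = pval (Poly_Mapping.lookup P v) + pval (p v)"
proof -
  have "pval (laurent_eval P p) \<in> (\<lambda>v. pval (Poly_Mapping.lookup P v) + pval (p v)) ` Poly_Mapping.keys P"
    unfolding laurent_eval_Kpos(2)[OF assms] using assms(1) by (intro Min_in) (auto simp: positive_laurent_def)
  then show ?thesis using that by blast
qed

lemma complete_laurent_pullback:
  assumes inv: "inverse_rational_maps n1 n2 \<phi> \<psi>" and W: "positive_laurent n2 W" and W': "positive_laurent n1 W'"
    and eq: "pullback_laurent \<phi> W = Fract W' 1" and complete: "complete_laurent n2 W"
  shows "complete_laurent n1 W'"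
proof (rule complete_laurentI)
  show "W' \<in> laurents n1" "W' \<noteq> 0" using W' by (simp_all add: positive_laurent_def)
  fix x :: "nat \<Rightarrow> real" and j
  assume x: "\<And>v. v \<in> Poly_Mapping.keys W' \<Longrightarrow> 0 \<le> (\<Sum>i<n1. of_int (Poly_Mapping.lookup v i) * x i)"
    and j: "j < n1"
  have \<phi>: "positive_rational_map n1 n2 \<phi>" and \<psi>: "positive_rational_map n2 n1 \<psi>"
    using inv by (simp_all add: inverse_rational_maps_def)
  let ?absval = "\<lambda>R. \<Sum>v\<in>Poly_Mapping.keys R. \<bar>pval (Poly_Mapping.lookup R v)\<bar>"
  have absval: "\<bar>pval (Poly_Mapping.lookup R v)\<bar> \<le> ?absval R" if "v \<in> Poly_Mapping.keys R" for R :: laurent and v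
    using that by (intro member_le_sum[where f = "\<lambda>v. \<bar>pval (Poly_Mapping.lookup R v)\<bar>"]) auto
  \<comment> \<open>The coefficients of \<open>W'\<close> enter the lower bound for the common value
    of \<open>W'\<close> and \<open>W\<close>; those of \<open>W\<close> enter in passing from that
    value to single characters.\<close>
  define c where "c = ?absval W' + ?absval W"
  obtain e :: real where e: "e > 0" "\<And>Y c j. (\<And>v. v \<in> Poly_Mapping.keys W \<Longrightarrow>
      - c \<le> (\<Sum>i<n2. of_int (Poly_Mapping.lookup v i) * Y i)) \<Longrightarrow> j < n2 \<Longrightarrow> e * \<bar>Y j\<bar> \<le> c"
    using complete_laurent_bound[OF complete] by blast
  \<comment> \<open>\<open>?size\<close> will bound the valuation of a character at
    \<open>q s\<close>, and \<open>K\<close> that of a positive Laurent polynomial; neither involves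
    \<open>s\<close>.\<close>
  let ?size = "\<lambda>v. \<Sum>i<n2. \<bar>of_int (Poly_Mapping.lookup v i)\<bar> * (c / e)"
  define K where "K R = ?absval R + (\<Sum>v\<in>Poly_Mapping.keys R. ?size v)" for R :: laurent
  define p where "p s = (\<lambda>v\<in>lat n1. puiseux_monom (\<Sum>i<n1. of_int (Poly_Mapping.lookup v i) * (s * x i)))" for s
  have p: "p s \<in> pos_points n1" for s unfolding p_def by (rule one_parameter_pos_points)
  have pval_p: "pval (p s v) = s * (\<Sum>i<n1. of_int (Poly_Mapping.lookup v i) * x i)" if "v \<in> lat n1" for s v
    using that by (simp add: p_def pval_puiseux_monom sum_distrib_left ac_simps)
  define q where "q s = map_points n1 n2 \<phi> (p s)" for s
  have q: "q s \<in> pos_points n2" for s unfolding q_def by (rule map_points_pos_points[OF \<phi> p])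
  have pval_q: "pval (q s v) = (\<Sum>i<n2. of_int (Poly_Mapping.lookup v i) * pval (q s (Poly_Mapping.single i 1)))"
    if "v \<in> lat n2" for s v
  proof (rule additive_on_lat[OF _ that])
    show "pval (q s (v + w)) = pval (q s v) + pval (q s w)" if "v \<in> lat n2" "w \<in> lat n2" for v w
      using q[of s] that Kpos_mult(2) pos_points_Kpos[OF q] by (simp add: pos_points_def)
  qed
  have W_q: "laurent_eval W (q s) = laurent_eval W' (p s)" for s
  proof -
    interpret torus_point n1 "\<lambda>c. c" "p s" by (rule torus_point_pos_point[OF p])
    have "ratfun_value n1 (\<lambda>c. c) (p s) (pullback_laurent \<phi> W) (laurent_subst (\<lambda>c. c) (q s) W)"
      unfolding q_def
      by (rule ratfun_value_pullback_laurent[OF map_points_value(1)[OF \<phi> p] positive_laurent_laurents[OF W]])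
    then show ?thesis
      unfolding eq laurent_eval_eq_subst
      by (rule ratfun_value_unique[OF _ ratfun_value_Fract_one[OF positive_laurent_laurents[OF W']]])
  qed
  \<comment> \<open>The minimum for \<open>W'\<close> is attained at an exponent on which
    \<open>x\<close> is nonnegative, and each term of \<open>W\<close> has at least the valuation of
    the sum.\<close>
  have q_lower: "- c \<le> pval (q s v)" if s: "0 \<le> s" and v: "v \<in> Poly_Mapping.keys W" for s v
  proof -
    obtain v' where v': "v' \<in> Poly_Mapping.keys W'"
        "pval (laurent_eval W' (p s)) = pval (Poly_Mapping.lookup W' v') + pval (p s v')"
      using pval_laurent_eval_attained[OF W' p] .
    have "v' \<in> lat n1" using v'(1) W' by (auto simp: positive_laurent_def laurents_def)
    then have "0 \<le> pval (p s v')" using x[OF v'(1)] s by (simp add: pval_p)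
    then show ?thesis
      using pval_laurent_eval_le[OF W q v, of s] absval[OF v] absval[OF v'(1)] v'(2)
      unfolding W_q c_def by linarith
  qed
  have q_bound: "\<bar>pval (q s v)\<bar> \<le> ?size v" if s: "0 \<le> s" and v: "v \<in> lat n2" for s v
  proof -
    have "\<bar>pval (q s (Poly_Mapping.single i 1))\<bar> \<le> c / e" if i: "i < n2" for i
    proof -
      have "e * \<bar>pval (q s (Poly_Mapping.single i 1))\<bar> \<le> c"
      proof (rule e(2)[OF _ i])
        fix v assume v: "v \<in> Poly_Mapping.keys W"
        then have "v \<in> lat n2" using W by (auto simp: positive_laurent_def laurents_def)
        then show "- c \<le> (\<Sum>i<n2. of_int (Poly_Mapping.lookup v i) * pval (q s (Poly_Mapping.single i 1)))"
          using q_lower[OF s v] pval_q by simp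
      qed
      then show ?thesis using e(1) by (simp add: field_simps)
    qed
    then show ?thesis
      unfolding pval_q[OF v]
      by (intro order_trans[OF sum_abs] sum_mono, unfold abs_mult of_int_abs) (intro mult_left_mono, auto)
  qed
  have K: "\<bar>pval (laurent_eval R (q s))\<bar> \<le> K R" if s: "0 \<le> s" and R: "positive_laurent n2 R" for s R
  proof -
    obtain v where v: "v \<in> Poly_Mapping.keys R"
        "pval (laurent_eval R (q s)) = pval (Poly_Mapping.lookup R v) + pval (q s v)"
      using pval_laurent_eval_attained[OF R q] .
    have "v \<in> lat n2" using v(1) R by (auto simp: positive_laurent_def laurents_def)
    have "0 \<le> c" by (simp add: c_def sum_nonneg)
    then have "?size v \<le> (\<Sum>v\<in>Poly_Mapping.keys R. ?size v)"
      using v(1) e(1) by (intro member_le_sum[where f = ?size]) (auto intro!: sum_nonneg)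
    then show ?thesis
      using q_bound[OF s \<open>v \<in> lat n2\<close>] absval[OF v(1)] unfolding v(2) K_def by linarith
  qed
  let ?ej = "Poly_Mapping.single j 1 :: lattice"
  have ej: "?ej \<in> lat n1" using j by (rule single_in_lat)
  obtain P Q where PQ: "positive_laurent n2 P" "positive_laurent n2 Q" "\<psi> ?ej = Fract P Q"
    using positive_rational_mapE[OF \<psi> ej] .
  \<comment> \<open>Recovering \<open>p s\<close> through the inverse map turns
    \<open>s * x j\<close> into a difference of two bounded valuations.\<close>
  have bound: "\<bar>s * x j\<bar> \<le> K P + K Q" if s: "0 \<le> s" for s
  proof -
    have "(\<Sum>i<n1. of_int (Poly_Mapping.lookup ?ej i) * x i) = (\<Sum>i<n1. if i = j then x i else 0)"
      by (rule sum.cong) (auto simp: lookup_single when_def)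
    then have "s * x j = pval (p s ?ej)"
      using j by (simp add: pval_p[OF ej])
    also have "\<dots> = pval (map_points n2 n1 \<psi> (q s) ?ej)"
      unfolding q_def map_points_inverse[OF inv p] ..
    also have "\<dots> = pval (laurent_eval P (q s)) - pval (laurent_eval Q (q s))"
      using ej PQ q by (simp add: map_points_def ratfun_eval_Fract(1) Kpos_divide(2) laurent_eval_Kpos(1))
    finally show ?thesis using K[OF s PQ(1)] K[OF s PQ(2)] by linarith
  qed
  show "x j = 0"
  proof (rule ccontr)
    assume nz: "x j \<noteq> 0"
    \<comment> \<open>Makes the \<open>s\<close> chosen next nonnegative; for it
      \<open>\<bar>s * x j\<bar>\<close> is \<open>K P + K Q + 1\<close>.\<close>
    have "0 \<le> K P + K Q" using bound[of 0] by simp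
    then show False using bound[of "(K P + K Q + 1) / \<bar>x j\<bar>"] nz by (simp add: abs_mult)
  qed
qed

text \<open>The equation with \<open>Fract W' 1\<close> encodes that the pullback of
  \<open>W\<close>, a priori a rational function, is a Laurent polynomial.\<close>

theorem proposition8p2:
  fixes n1 n2 :: nat and \<phi> :: "lattice \<Rightarrow> ratfun" and W W' :: laurent
  assumes "positively_birational n1 n2 \<phi>"
    and "positive_laurent n2 W"
    and "positive_laurent n1 W'" and "pullback_laurent \<phi> W = Fract W' 1"
    and "complete_laurent n2 W"
  shows "complete_laurent n1 W' \<and>
    (\<forall>p'. unique_positive_critical_point n1 W' p' \<longrightarrow>
       map_points n1 n2 \<phi> p' \<in> pos_points n2 \<and>
       unique_positive_critical_point n2 W (map_points n1 n2 \<phi> p')) \<and>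
    (\<forall>p p'. unique_positive_critical_point n2 W p \<and> unique_positive_critical_point n1 W' p' \<longrightarrow>
       Trop_map n1 n2 \<phi> (trop_class n1 p') = trop_class n2 p)"
proof -
  obtain \<psi> where inv: "inverse_rational_maps n1 n2 \<phi> \<psi>"
    using positively_birationalE[OF assms(1)] .
  have \<phi>: "positive_rational_map n1 n2 \<phi>" using inv by (simp add: inverse_rational_maps_def)
  have image: "unique_positive_critical_point n2 W (map_points n1 n2 \<phi> p')"
    if "unique_positive_critical_point n1 W' p'" for p'
    using unique_critical_point_image[OF inv _ _ assms(4) that] assms(2,3)
    by (simp add: positive_laurent_laurents)
  show ?thesis
  proof (intro conjI allI impI)
    show "complete_laurent n1 W'"
      by (rule complete_laurent_pullback[OF inv assms(2-5)])
  next
    fix p' assume p': "unique_positive_critical_point n1 W' p'"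
    show "unique_positive_critical_point n2 W (map_points n1 n2 \<phi> p')" by (rule image[OF p'])
    then show "map_points n1 n2 \<phi> p' \<in> pos_points n2"
      unfolding unique_positive_critical_point_def positive_critical_point_def by blast
  next
    fix p p' assume *: "unique_positive_critical_point n2 W p \<and> unique_positive_critical_point n1 W' p'"
    then have "p' \<in> pos_points n1"
      unfolding unique_positive_critical_point_def positive_critical_point_def by blast
    then have "Trop_map n1 n2 \<phi> (trop_class n1 p') = trop_class n2 (map_points n1 n2 \<phi> p')"
      by (rule Trop_map_trop_class[OF \<phi>])
    also have "map_points n1 n2 \<phi> p' = p"
      using * image[of p'] unfolding unique_positive_critical_point_def by blast
    finally show "Trop_map n1 n2 \<phi> (trop_class n1 p') = trop_class n2 p" .
  qed
qed

end
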